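(* Let $\mathbf J_e\in L_2(0,T;\mathbf L_{2,\varepsilon_0^{-1}(1+\chi^{(1)})^{-1}}(\Omega))$ and $\mathbf J_m\in L_2(0,T;\mathbf L_{2,\mu_0^{-1}}(\Omega))$ be given, and assume that the system $$(\varepsilon(\mathbf E)\partial_t\mathbf E,\Psi)-(\nabla\times\mathbf H,\Psi)=-(\mathbf J_e,\Psi)\quad\forall\,\Psi\in\mathbf L_2(\Omega),$$ $$(\mu_0\partial_t\mathbf H,\Phi)+(\mathbf E,\nabla\times\Phi)=-(\mathbf J_m,\Phi)\quad\forall\,\Phi\in\mathbf H(\mathrm{curl},\Omega),$$ on $(0,T)$, together with the initial conditions $\mathbf E(0)=\mathbf E_0$, $\mathbf H(0)=\mathbf H_0$, has a weak solution $$(\mathbf E,\mathbf H)\in\big(C^1(0,T;\mathbf L_{2,\varepsilon(\mathbf E)}(\Omega))\cap C(0,T;\mathbf H_0(\mathrm{curl},\Omega))\big)\times\big(C^1(0,T;\mathbf L_2(\Omega))\cap C(0,T;\mathbf H(\mathrm{curl},\Omega))\big).$$ Let $$W(t):=\frac12\Big[\|\mathbf E(t)\|_{\varepsilon_0(1+\chi^{(1)})}^2+\frac32\big\||\mathbf E(t)|^2\big\|_{\varepsilon_0\chi^{(3)}}^2+\|\mathbf H(t)\|_{\mu_0}^2\Big].$$ Then for all $t\in(0,T)$, $$W(t)\le 2W(0)+t\Big[\|\mathbf J_e\|_{L_2(0,T;\mathbf L_{2,\varepsilon_0^{-1}(1+\chi^{(1)})^{-1}}(\Omega))}^2+\|\mathbf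 J_m\|_{L_2(0,T;\mathbf L_{2,\mu_0^{-1}}(\Omega))}^2\Big].$$
   Context: $\Omega\subset\mathbb R^3$ is a simply connected domain with sufficiently smooth boundary $\partial\Omega$ and outward unit normal $\nu$; $T>0$; $\varepsilon_0,\mu_0>0$ are constants. The susceptibility coefficients $\chi^{(1)},\chi^{(3)}:\Omega\to\mathbb R$ are measurable with $\chi^{(1)},\chi^{(3)}\ge0$ a.e. in $\Omega$. For a vector (field) $\mathbf E$, $$\varepsilon(\mathbf E):=\varepsilon_0\big((1+\chi^{(1)}+\chi^{(3)}|\mathbf E|^2)\mathbf I+2\chi^{(3)}\mathbf E\mathbf E^\top\big),$$ with $\mathbf I$ the $3\times3$ identity matrix. The initial data are given fields $\mathbf E_0,\mathbf H_0:\Omega\to\mathbb R^3$, where $\mathbf H_0$ satisfies $\nabla\cdot(\mu_0\mathbf H_0)=0$ in $\Omega$ and $\mathbf H_0\cdot\nu=0$ on $\partial\Omega$; $W(0)$ is the value of the energy at $(\mathbf E(0),\mathbf H(0))=(\mathbf E_0,\mathbf H_0)$. $\mathbf L_2(\Omega)=[L^2(\Omega)]^3$ and $(\mathbf u,\mathbf v)=\int_\Omega\mathbf u\cdot\mathbf v\,d\mathbf x$. For a scalar weight $\omega$, $\|\mathbf u\|_\omega^2=\int_\Omega\omega|\mathbf u|^2d\mathbf x$ (in particular $\||\mathbf E|^2\|_{\varepsilon_0\chi^{(3)}}^2=\int_\Omega\varepsilon_0\chi^{(3)}|\mathbf E|^4d\mathbf x$), and $\mathbf L_{2,\omega}(\Omega)$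 is the space of measurable fields with finite norm. For the matrix weight $\varepsilon(\mathbf E)$, the norm is $\|\mathbf u\|_{\varepsilon(\mathbf E)}^2=\int_\Omega\mathbf u^\top\varepsilon(\mathbf E)\mathbf u\,d\mathbf x$; since this weight depends on $t$ through $\mathbf E(t)$, $\mathbf u\in C^1(0,T;\mathbf L_{2,\varepsilon(\mathbf E)}(\Omega))$ is understood as: $\mathbf u\in C^1(0,T;\mathbf L_2(\Omega))$ and, for $j=0,1$, the map $t\mapsto\varepsilon(\mathbf E(t))^{1/2}\mathbf u^{(j)}(t)$ is continuous and bounded from $(0,T)$ to $\mathbf L_2(\Omega)$. $\mathbf H(\mathrm{curl},\Omega)=\{\mathbf u\in\mathbf L_2(\Omega):\nabla\times\mathbf u\in\mathbf L_2(\Omega)\}$; $\mathbf H_0(\mathrm{curl},\Omega)=\{\mathbf u\in\mathbf H(\mathrm{curl},\Omega):\mathbf u\times\nu|_{\partial\Omega}=0\}$. $C^m(0,T;X)$ is the space of functions $(0,T)\to X$ with continuous derivatives up to order $m$, with norm $\sum_{j=0}^m\sup_{t\in(0,T)}\|\mathbf u^{(j)}(t)\|_X$, and $C=C^0$. $L_2(0,T;X)$ is the space of strongly measurable $\mathbf u:(0,T)\to X$ with $\|\mathbf u\|_{L_2(0,T;X)}^2=\int_0^T\|\mathbf u(t)\|_X^2dt<\infty$. The variational equations are required for all $t\in(0,T)$, and the initial conditions are understood in the sense of continuity in time with values in $\mathbf L_2(\Omega)$. *)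

theory Defs
  imports "HOL-Analysis.Analysis"
begin

text \<open>
  Fields are honest functions on \<open>real^3\<close>; only their values on \<open>\<Omega>\<close> matter, and elements of
  Lebesgue spaces are represented by functions without passing to classes modulo null sets.
\<close>

type_synonym field = "real^3 \<Rightarrow> real^3"

text \<open>Partial derivatives up to order \<open>k\<close> exist and are continuous; meant for open \<open>S\<close>.\<close>

primrec Ck_on :: "nat \<Rightarrow> 'a::euclidean_space set \<Rightarrow> ('a \<Rightarrow> 'b::real_normed_vector) \<Rightarrow> bool" where
  "Ck_on 0 S f \<longleftrightarrow> continuous_on S f"
| "Ck_on (Suc k) S f \<longleftrightarrow> (\<forall>x\<in>S. f differentiable (at x)) \<and>
     (\<forall>v. Ck_on k S (\<lambda>x. frechet_derivative f (at x) v))"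

definition grad :: "(real^3 \<Rightarrow> real) \<Rightarrow> field" where
  "grad f x = (\<chi> i. frechet_derivative f (at x) (axis i 1))"

text \<open>
  Near each boundary point \<open>\<Omega>\<close> is the sublevel set of a regular defining function \<open>\<rho>\<close> of class
  \<open>C\<^sup>k\<close>; the outward unit normal is then \<open>grad \<rho> / norm (grad \<rho>)\<close>.
\<close>

definition Ck_boundary :: "nat \<Rightarrow> (real^3) set \<Rightarrow> bool" where
  "Ck_boundary k \<Omega> \<longleftrightarrow> (\<forall>p\<in>frontier \<Omega>. \<exists>U \<rho>. open U \<and> p \<in> U \<and> Ck_on k U \<rho> \<and>
     (\<forall>x\<in>U. grad \<rho> x \<noteq> 0) \<and> \<Omega> \<inter> U = {x\<in>U. \<rho> x < 0})"

definition simply_connected_domain :: "(real^3) set \<Rightarrow> bool" where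
  "simply_connected_domain \<Omega> \<longleftrightarrow> open \<Omega> \<and> connected \<Omega> \<and> \<Omega> \<noteq> {} \<and> simply_connected \<Omega>"

text \<open>
  All norms are handled through their squares, with values in \<open>ennreal\<close>, so that an infinite
  norm really is \<open>\<infinity>\<close>.
\<close>

definition sqnorm ::
  "(real^3) set \<Rightarrow> (real^3 \<Rightarrow> real) \<Rightarrow> (real^3 \<Rightarrow> 'b::real_normed_vector) \<Rightarrow> ennreal" where
  "sqnorm \<Omega> w u = (\<integral>\<^sup>+x. ennreal (w x * (norm (u x))\<^sup>2) \<partial>lebesgue_on \<Omega>)"

definition L2w ::
  "(real^3) set \<Rightarrow> (real^3 \<Rightarrow> real) \<Rightarrow> (real^3 \<Rightarrow> 'b::real_normed_vector) set" where
  "L2w \<Omega> w = {u. u \<in> borel_measurable (lebesgue_on \<Omega>) \<and> sqnorm \<Omega> w u < \<infinity>}"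

abbreviation L2_sqnorm :: "(real^3) set \<Rightarrow> (real^3 \<Rightarrow> 'b::real_normed_vector) \<Rightarrow> ennreal" where
  "L2_sqnorm \<Omega> \<equiv> sqnorm \<Omega> (\<lambda>_. 1)"

abbreviation L2 :: "(real^3) set \<Rightarrow> (real^3 \<Rightarrow> 'b::real_normed_vector) set" where
  "L2 \<Omega> \<equiv> L2w \<Omega> (\<lambda>_. 1)"

definition pairing_exists :: "(real^3) set \<Rightarrow> field \<Rightarrow> field \<Rightarrow> bool" where
  "pairing_exists \<Omega> u v \<longleftrightarrow> integrable (lebesgue_on \<Omega>) (\<lambda>x. u x \<bullet> v x)"

definition pairing :: "(real^3) set \<Rightarrow> field \<Rightarrow> field \<Rightarrow> real" where
  "pairing \<Omega> u v = (LINT x|lebesgue_on \<Omega>. u x \<bullet> v x)"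

definition test_functions :: "(real^3) set \<Rightarrow> (real^3 \<Rightarrow> 'b::real_normed_vector) set" where
  "test_functions S = {\<phi>. (\<forall>k. Ck_on k UNIV \<phi>) \<and> compact (closure {x. \<phi> x \<noteq> 0}) \<and>
     closure {x. \<phi> x \<noteq> 0} \<subseteq> S}"

definition partial :: "3 \<Rightarrow> 3 \<Rightarrow> field \<Rightarrow> real^3 \<Rightarrow> real" where
  "partial i j \<phi> x = frechet_derivative \<phi> (at x) (axis i 1) $ j"

definition classical_curl :: "field \<Rightarrow> field" where
  "classical_curl \<phi> x = vector
     [partial 2 3 \<phi> x - partial 3 2 \<phi> x,
      partial 3 1 \<phi> x - partial 1 3 \<phi> x,
      partial 1 2 \<phi> x - partial 2 1 \<phi> x]"

definition has_weak_curl :: "(real^3) set \<Rightarrow> field \<Rightarrow> field \<Rightarrow> bool" where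
  "has_weak_curl \<Omega> u v \<longleftrightarrow>
     (\<forall>\<phi>\<in>test_functions \<Omega>. pairing \<Omega> v \<phi> = pairing \<Omega> u (classical_curl \<phi>))"

definition Hcurl :: "(real^3) set \<Rightarrow> field set" where
  "Hcurl \<Omega> = {u \<in> L2 \<Omega>. \<exists>v\<in>L2 \<Omega>. has_weak_curl \<Omega> u v}"

definition curl :: "(real^3) set \<Rightarrow> field \<Rightarrow> field" where
  "curl \<Omega> u = (SOME v. v \<in> L2 \<Omega> \<and> has_weak_curl \<Omega> u v)"

definition Hcurl_sqnorm :: "(real^3) set \<Rightarrow> field \<Rightarrow> ennreal" where
  "Hcurl_sqnorm \<Omega> u = L2_sqnorm \<Omega> u + L2_sqnorm \<Omega> (curl \<Omega> u)"

text \<open>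
  The tangential trace \<open>u \<times> \<nu>\<close> of a field in \<open>Hcurl\<close> exists only as a functional on (restrictions
  to the boundary of) smooth fields, defined by Green's formula: if \<open>u\<close> is smooth up to the
  boundary, the value at \<open>\<phi>\<close> is the surface integral of \<open>(u \<times> \<nu>) \<bullet> \<phi>\<close>.
\<close>

definition tangential_trace :: "(real^3) set \<Rightarrow> field \<Rightarrow> field \<Rightarrow> real" where
  "tangential_trace \<Omega> u \<phi> = pairing \<Omega> u (classical_curl \<phi>) - pairing \<Omega> (curl \<Omega> u) \<phi>"

definition H0curl :: "(real^3) set \<Rightarrow> field set" where
  "H0curl \<Omega> = {u \<in> Hcurl \<Omega>. \<forall>\<phi>\<in>test_functions UNIV. tangential_trace \<Omega> u \<phi> = 0}"

definition has_weak_div :: "(real^3) set \<Rightarrow> field \<Rightarrow> (real^3 \<Rightarrow> real) \<Rightarrow> bool" where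
  "has_weak_div \<Omega> u g \<longleftrightarrow>
     (\<forall>\<phi>\<in>test_functions \<Omega>. (LINT x|lebesgue_on \<Omega>. g x * \<phi> x) = - pairing \<Omega> u (grad \<phi>))"

definition divergence :: "(real^3) set \<Rightarrow> field \<Rightarrow> real^3 \<Rightarrow> real" where
  "divergence \<Omega> u = (SOME g. g \<in> L2 \<Omega> \<and> has_weak_div \<Omega> u g)"

text \<open>
  Likewise the normal trace \<open>u \<bullet> \<nu>\<close>, for \<open>u\<close> with square integrable weak divergence: for \<open>u\<close>
  smooth up to the boundary this is the surface integral of \<open>(u \<bullet> \<nu>) \<phi>\<close>.
\<close>

definition normal_trace :: "(real^3) set \<Rightarrow> field \<Rightarrow> (real^3 \<Rightarrow> real) \<Rightarrow> real" where
  "normal_trace \<Omega> u \<phi> =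
     pairing \<Omega> u (grad \<phi>) + (LINT x|lebesgue_on \<Omega>. divergence \<Omega> u x * \<phi> x)"

text \<open>
  In the spaces of functions of time below, \<open>X\<close> is a space of fields and \<open>N\<close> the square of its norm.  As the norm of
  \<open>C(0,T;X)\<close> is a supremum over the open interval, its elements are bounded.
\<close>

definition C0_time ::
  "real \<Rightarrow> field set \<Rightarrow> (field \<Rightarrow> ennreal) \<Rightarrow> (real \<Rightarrow> field) set" where
  "C0_time T X N = {u. (\<forall>t\<in>{0<..<T}. u t \<in> X) \<and>
     (\<forall>t\<in>{0<..<T}. ((\<lambda>s. N (\<lambda>x. u s x - u t x)) \<longlongrightarrow> 0) (at t)) \<and>
     (\<exists>B::real. \<forall>t\<in>{0<..<T}. N (u t) \<le> ennreal B)}"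

definition has_time_derivative ::
  "real \<Rightarrow> (field \<Rightarrow> ennreal) \<Rightarrow> (real \<Rightarrow> field) \<Rightarrow> (real \<Rightarrow> field) \<Rightarrow> bool" where
  "has_time_derivative T N u u' \<longleftrightarrow> (\<forall>t\<in>{0<..<T}.
     ((\<lambda>s. N (\<lambda>x. (u s x - u t x) /\<^sub>R (s - t) - u' t x)) \<longlongrightarrow> 0) (at t))"

definition C1_time_with_derivative ::
  "real \<Rightarrow> field set \<Rightarrow> (field \<Rightarrow> ennreal) \<Rightarrow> (real \<Rightarrow> field) \<Rightarrow> (real \<Rightarrow> field) \<Rightarrow> bool" where
  "C1_time_with_derivative T X N u u' \<longleftrightarrow>
     u \<in> C0_time T X N \<and> u' \<in> C0_time T X N \<and> has_time_derivative T N u u'"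

definition strongly_measurable ::
  "real \<Rightarrow> field set \<Rightarrow> (field \<Rightarrow> ennreal) \<Rightarrow> (real \<Rightarrow> field) \<Rightarrow> bool" where
  "strongly_measurable T X N u \<longleftrightarrow> (\<exists>s :: nat \<Rightarrow> real \<Rightarrow> field.
     (\<forall>n. simple_function (lebesgue_on {0<..<T}) (s n) \<and> (\<forall>t\<in>{0<..<T}. s n t \<in> X)) \<and>
     (AE t in lebesgue_on {0<..<T}. (\<lambda>n. N (\<lambda>x. s n t x - u t x)) \<longlonglongrightarrow> 0))"

definition L2_time_sqnorm :: "real \<Rightarrow> (field \<Rightarrow> ennreal) \<Rightarrow> (real \<Rightarrow> field) \<Rightarrow> ennreal" where
  "L2_time_sqnorm T N u = (\<integral>\<^sup>+t. N (u t) \<partial>lebesgue_on {0<..<T})"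

definition L2_time ::
  "real \<Rightarrow> field set \<Rightarrow> (field \<Rightarrow> ennreal) \<Rightarrow> (real \<Rightarrow> field) set" where
  "L2_time T X N = {u. (\<forall>t\<in>{0<..<T}. u t \<in> X) \<and> strongly_measurable T X N u \<and>
     L2_time_sqnorm T N u < \<infinity>}"

text \<open>Here \<open>c1\<close>, \<open>c3\<close> are the values of the susceptibilities at a point and \<open>e\<close> that of the field.\<close>

definition permittivity :: "real \<Rightarrow> real \<Rightarrow> real \<Rightarrow> real^3 \<Rightarrow> real^3^3" where
  "permittivity eps0 c1 c3 e =
     eps0 *\<^sub>R ((1 + c1 + c3 * (norm e)\<^sup>2) *\<^sub>R mat 1 + (2 * c3) *\<^sub>R (\<chi> i j. e $ i * e $ j))"

text \<open>The choice is unambiguous: this is the unique positive semidefinite square root of a positive semidefinite matrix.\<close>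

definition psd_sqrt :: "real^3^3 \<Rightarrow> real^3^3" where
  "psd_sqrt A = (SOME B. transpose B = B \<and> (\<forall>v. 0 \<le> v \<bullet> (B *v v)) \<and> B ** B = A)"

definition energy :: "(real^3) set \<Rightarrow> real \<Rightarrow> real \<Rightarrow> (real^3 \<Rightarrow> real) \<Rightarrow> (real^3 \<Rightarrow> real)
    \<Rightarrow> field \<Rightarrow> field \<Rightarrow> ennreal" where
  "energy \<Omega> eps0 mu0 chi1 chi3 E H = 1/2 *
     (sqnorm \<Omega> (\<lambda>x. eps0 * (1 + chi1 x)) E
      + 3/2 * sqnorm \<Omega> (\<lambda>x. eps0 * chi3 x) (\<lambda>x. (norm (E x))\<^sup>2)
      + sqnorm \<Omega> (\<lambda>_. mu0) H)"

text \<open>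
  The weight depends on time through \<open>E\<close>, so this is not a space of functions with values in one
  fixed normed space; \<open>u'\<close> is the time derivative of \<open>u\<close> in \<open>L2\<close>.
\<close>

definition C1_time_permittivity :: "(real^3) set \<Rightarrow> real \<Rightarrow> real \<Rightarrow> (real^3 \<Rightarrow> real) \<Rightarrow>
    (real^3 \<Rightarrow> real) \<Rightarrow> (real \<Rightarrow> field) \<Rightarrow> (real \<Rightarrow> field) \<Rightarrow> (real \<Rightarrow> field) \<Rightarrow> bool" where
  "C1_time_permittivity \<Omega> T eps0 chi1 chi3 E u u' \<longleftrightarrow>
     C1_time_with_derivative T (L2 \<Omega>) (L2_sqnorm \<Omega>) u u' \<and>
     (\<forall>w\<in>{u, u'}. (\<lambda>t x. psd_sqrt (permittivity eps0 (chi1 x) (chi3 x) (E t x)) *v w t x)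
        \<in> C0_time T (L2 \<Omega>) (L2_sqnorm \<Omega>))"

definition initial_value :: "(real^3) set \<Rightarrow> (real \<Rightarrow> field) \<Rightarrow> field \<Rightarrow> bool" where
  "initial_value \<Omega> u u0 \<longleftrightarrow>
     u0 \<in> L2 \<Omega> \<and> ((\<lambda>t. L2_sqnorm \<Omega> (\<lambda>x. u t x - u0 x)) \<longlongrightarrow> 0) (at_right 0)"

text \<open>
  For \<open>\<Psi>\<close> in \<open>L2\<close> the products with \<open>\<epsilon>(E) \<partial>\<^sub>t E\<close> and \<open>J\<^sub>e\<close> need not be integrable a priori when the
  susceptibilities are unbounded; that these two pairings exist is part of the first equation.
  All other pairings are between square integrable fields.
\<close>

definition weak_solution :: "(real^3) set \<Rightarrow> real \<Rightarrow> real \<Rightarrow> real \<Rightarrow> (real^3 \<Rightarrow> real) \<Rightarrow>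
    (real^3 \<Rightarrow> real) \<Rightarrow> (real \<Rightarrow> field) \<Rightarrow> (real \<Rightarrow> field) \<Rightarrow> field \<Rightarrow> field \<Rightarrow>
    (real \<Rightarrow> field) \<Rightarrow> (real \<Rightarrow> field) \<Rightarrow> bool" where
  "weak_solution \<Omega> T eps0 mu0 chi1 chi3 Je Jm E0 H0 E H \<longleftrightarrow>
     E \<in> C0_time T (H0curl \<Omega>) (Hcurl_sqnorm \<Omega>) \<and>
     H \<in> C0_time T (Hcurl \<Omega>) (Hcurl_sqnorm \<Omega>) \<and>
     (\<exists>E' H'.
        C1_time_permittivity \<Omega> T eps0 chi1 chi3 E E E' \<and>
        C1_time_with_derivative T (L2 \<Omega>) (L2_sqnorm \<Omega>) H H' \<and>
        (\<forall>t\<in>{0<..<T}. \<forall>\<Psi>\<in>L2 \<Omega>.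
           let D' = (\<lambda>x. permittivity eps0 (chi1 x) (chi3 x) (E t x) *v E' t x) in
           pairing_exists \<Omega> D' \<Psi> \<and> pairing_exists \<Omega> (Je t) \<Psi> \<and>
           pairing \<Omega> D' \<Psi> - pairing \<Omega> (curl \<Omega> (H t)) \<Psi> = - pairing \<Omega> (Je t) \<Psi>) \<and>
        (\<forall>t\<in>{0<..<T}. \<forall>\<Phi>\<in>Hcurl \<Omega>.
           pairing \<Omega> (\<lambda>x. mu0 *\<^sub>R H' t x) \<Phi> + pairing \<Omega> (E t) (curl \<Omega> \<Phi>)
             = - pairing \<Omega> (Jm t) \<Phi>)) \<and>
     initial_value \<Omega> E E0 \<and> initial_value \<Omega> H H0"

end

theory Submission
  imports Defs
begin

text \<open>
  Put \<open>Z = ((\<epsilon>\<^sub>0(1 + \<chi>\<^sub>1))\<^sup>1\<^sup>/\<^sup>2 E, (3\<epsilon>\<^sub>0\<chi>\<^sub>3/2)\<^sup>1\<^sup>/\<^sup>2 |E|\<^sup>2, \<mu>\<^sub>0\<^sup>1\<^sup>/\<^sup>2 H)\<close>, so that \<open>2W = \<parallel>Z\<parallel>\<^sup>2\<close>.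
  The bound on \<open>\<epsilon>(E)\<^sup>1\<^sup>/\<^sup>2 \<partial>\<^sub>tE\<close> makes the formal time derivative \<open>Z'\<close> bounded in \<open>L\<^sup>2\<close>; hence \<open>Z\<close> is
  Lipschitz in \<open>L\<^sup>2\<close> up to \<open>t = 0\<close> and weakly differentiable, and \<open>\<parallel>Z\<parallel>\<^sup>2\<close> is differentiable with
  derivative \<open>2(Z, Z')\<close>.  Testing the two equations with \<open>E\<close> and \<open>H\<close> cancels the curl terms and
  gives \<open>(Z, Z') = -(J, Z)\<close>, where \<open>J\<close> collects the two currents divided by the square roots of
  the weights.  Therefore \<open>\<parallel>Z\<parallel>' \<le> \<parallel>J\<parallel>\<close>, so \<open>\<parallel>Z(t)\<parallel> \<le> \<parallel>Z(0)\<parallel> + (t \<integral>\<parallel>J\<parallel>\<^sup>2)\<^sup>1\<^sup>/\<^sup>2\<close>, and squaring costs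
  the factor 2.
\<close>

section \<open>Square integrable functions and their seminorm\<close>

definition sq_int :: "'a measure \<Rightarrow> ('a \<Rightarrow> 'b::euclidean_space) \<Rightarrow> bool" where
  "sq_int M u \<longleftrightarrow> u \<in> borel_measurable M \<and> integrable M (\<lambda>x. (norm (u x))\<^sup>2)"

text \<open>Meaningful only together with \<open>sq_int\<close>: the Bochner integral of a
  non-integrable function is 0. Functions are not identified modulo null sets, so this is a
  seminorm.\<close>

definition l2 :: "'a measure \<Rightarrow> ('a \<Rightarrow> 'b::euclidean_space) \<Rightarrow> real" where
  "l2 M u = sqrt (LINT x|M. (norm (u x))\<^sup>2)"

lemma l2_nonneg [simp]: "0 \<le> l2 M u"
  by (simp add: l2_def)

lemma l2_power2: "(l2 M u)\<^sup>2 = (LINT x|M. (norm (u x))\<^sup>2)"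
  by (simp add: l2_def)

lemma sq_int_integrable_inner:
  assumes "sq_int M u" "sq_int M v"
  shows "integrable M (\<lambda>x. u x \<bullet> v x)"
proof (rule Bochner_Integration.integrable_bound)
  show "integrable M (\<lambda>x. (norm (u x))\<^sup>2 + (norm (v x))\<^sup>2)"
    using assms by (simp add: sq_int_def)
  show "(\<lambda>x. u x \<bullet> v x) \<in> borel_measurable M"
    using assms by (intro borel_measurable_inner) (auto simp: sq_int_def)
  have "\<bar>u x \<bullet> v x\<bar> \<le> (norm (u x))\<^sup>2 + (norm (v x))\<^sup>2" for x
    using Cauchy_Schwarz_ineq2[of "u x" "v x"] sum_squares_bound[of "norm (u x)" "norm (v x)"]
      mult_nonneg_nonneg[OF norm_ge_zero norm_ge_zero, of "u x" "v x"]
    by linarith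
  then show "AE x in M. norm (u x \<bullet> v x) \<le> norm ((norm (u x))\<^sup>2 + (norm (v x))\<^sup>2)"
    by simp
qed

lemma sq_int_bound:
  fixes u :: "'a \<Rightarrow> 'b::euclidean_space" and v :: "'a \<Rightarrow> 'c::euclidean_space"
  assumes "sq_int M u" "v \<in> borel_measurable M" "AE x in M. norm (v x) \<le> C * norm (u x)"
  shows "sq_int M v"
  unfolding sq_int_def
proof
  show "v \<in> borel_measurable M" by fact
  show "integrable M (\<lambda>x. (norm (v x))\<^sup>2)"
  proof (rule Bochner_Integration.integrable_bound)
    show "integrable M (\<lambda>x. C\<^sup>2 * (norm (u x))\<^sup>2)"
      using assms by (simp add: sq_int_def)
    show "AE x in M. norm ((norm (v x))\<^sup>2) \<le> norm (C\<^sup>2 * (norm (u x))\<^sup>2)"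
      using assms(3)
    proof eventually_elim
      case (elim x)
      then have "(norm (v x))\<^sup>2 \<le> (C * norm (u x))\<^sup>2"
        by (intro power_mono) auto
      then show ?case by (simp add: power_mult_distrib)
    qed
  qed (use assms in measurable)
qed

lemma sq_int_diff:
  assumes "sq_int M u" "sq_int M v"
  shows "sq_int M (\<lambda>x. u x - v x)"
  unfolding sq_int_def
proof
  show "(\<lambda>x. u x - v x) \<in> borel_measurable M"
    using assms by (auto simp: sq_int_def)
  have "(norm (u x - v x))\<^sup>2 = (norm (u x))\<^sup>2 - 2 * (u x \<bullet> v x) + (norm (v x))\<^sup>2" for x
    by (simp add: power2_norm_eq_inner inner_diff inner_commute)
  then show "integrable M (\<lambda>x. (norm (u x - v x))\<^sup>2)"
    using assms sq_int_integrable_inner[OF assms] by (simp add: sq_int_def)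
qed

lemma sq_int_scaleR:
  assumes "sq_int M u"
  shows "sq_int M (\<lambda>x. c *\<^sub>R u x)"
  by (rule sq_int_bound[OF assms, where C="\<bar>c\<bar>"]) (use assms in \<open>auto simp: sq_int_def\<close>)

lemma sq_int_indicator:
  assumes "sq_int M u" "A \<in> sets M"
  shows "sq_int M (\<lambda>x. indicat_real A x *\<^sub>R u x)"
  by (rule sq_int_bound[OF assms(1), where C=1])
    (use assms in \<open>auto simp: sq_int_def indicator_def\<close>)

lemma l2_scaleR: "l2 M (\<lambda>x. c *\<^sub>R u x) = \<bar>c\<bar> * l2 M u"
  by (simp add: l2_def power_mult_distrib real_sqrt_mult)

lemma l2_indicator_le:
  assumes "sq_int M u" "A \<in> sets M"
  shows "l2 M (\<lambda>x. indicat_real A x *\<^sub>R u x) \<le> l2 M u"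
  unfolding l2_def
  by (intro real_sqrt_le_mono integral_mono)
    (use assms sq_int_indicator[OF assms] in \<open>auto simp: sq_int_def indicator_def\<close>)

text \<open>The integral of the squared norm of u - c v is a nonnegative quadratic polynomial in c;
  evaluating it at its minimum gives the inequality.\<close>

lemma l2_Cauchy_Schwarz:
  assumes u: "sq_int M u" and v: "sq_int M v"
  shows "\<bar>LINT x|M. u x \<bullet> v x\<bar> \<le> l2 M u * l2 M v"
proof -
  define P where "P = (LINT x|M. u x \<bullet> v x)"
  have uv: "integrable M (\<lambda>x. u x \<bullet> v x)"
    using u v by (rule sq_int_integrable_inner)
  have pos: "0 \<le> (l2 M u)\<^sup>2 - 2 * c * P + c\<^sup>2 * (l2 M v)\<^sup>2" for c
  proof -
    have "0 \<le> (LINT x|M. (norm (u x - c *\<^sub>R v x))\<^sup>2)"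
      by simp
    also have "\<dots> = (LINT x|M. ((norm (u x))\<^sup>2 - 2 * c * (u x \<bullet> v x)) + c\<^sup>2 * (norm (v x))\<^sup>2)"
      by (rule Bochner_Integration.integral_cong)
        (simp_all only: power2_norm_eq_inner, simp add: inner_diff inner_commute algebra_simps power2_eq_square)
    also have "\<dots> = (l2 M u)\<^sup>2 - 2 * c * P + c\<^sup>2 * (l2 M v)\<^sup>2"
      using u v uv by (simp add: sq_int_def l2_power2 P_def)
    finally show ?thesis .
  qed
  have "P\<^sup>2 \<le> (l2 M u)\<^sup>2 * (l2 M v)\<^sup>2"
  proof (cases "l2 M v = 0")
    case True
    have "P = 0"
    proof (rule ccontr)
      assume "P \<noteq> 0"
      \<comment> \<open>When \<open>l2 M v\<close> is 0 the polynomial is affine in c with slope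
        -2P, and this c gives it the value -1.\<close>
      with pos[of "((l2 M u)\<^sup>2 + 1) / (2 * P)"] True show False
        by (simp add: field_simps)
    qed
    then show ?thesis by simp
  next
    case False
    then have v0: "(l2 M v)\<^sup>2 > 0"
      by simp
    \<comment> \<open>The polynomial has its minimum at c = P divided by the square of
      \<open>l2 M v\<close>.\<close>
    have "(P / (l2 M v)\<^sup>2)\<^sup>2 * (l2 M v)\<^sup>2 = P\<^sup>2 / (l2 M v)\<^sup>2"
      using v0 by (simp add: power2_eq_square)
    then have "0 \<le> (l2 M u)\<^sup>2 - P\<^sup>2 / (l2 M v)\<^sup>2"
      using pos[of "P / (l2 M v)\<^sup>2"] by (simp add: power2_eq_square)
    then show ?thesis
      using v0 by (simp add: field_simps)
  qed
  then have "\<bar>P\<bar>\<^sup>2 \<le> (l2 M u * l2 M v)\<^sup>2"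
    by (simp add: power_mult_distrib)
  then show ?thesis
    unfolding P_def by (rule power2_le_imp_le) simp
qed

text \<open>Dominated convergence with the squared norm of \<open>u\<close> as majorant: at almost
  every point the truncation is eventually exact.\<close>

lemma l2_indicator_tendsto:
  assumes u: "sq_int M u" and A: "\<And>n. A n \<in> sets M" "AE x in M. \<forall>\<^sub>F n in sequentially. x \<in> A n"
  shows "(\<lambda>n. l2 M (\<lambda>x. u x - indicat_real (A n) x *\<^sub>R u x)) \<longlonglongrightarrow> 0"
proof -
  have "(\<lambda>n. LINT x|M. (norm (u x - indicat_real (A n) x *\<^sub>R u x))\<^sup>2) \<longlonglongrightarrow> (LINT x|M. 0)"
  proof (rule integral_dominated_convergence)
    show "integrable M (\<lambda>x. (norm (u x))\<^sup>2)"
      using u by (simp add: sq_int_def)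
    show "AE x in M. (\<lambda>n. (norm (u x - indicat_real (A n) x *\<^sub>R u x))\<^sup>2) \<longlonglongrightarrow> 0"
      using A(2)
    proof eventually_elim
      case (elim x)
      then have "\<forall>\<^sub>F n in sequentially. (norm (u x - indicat_real (A n) x *\<^sub>R u x))\<^sup>2 = 0"
        by eventually_elim (simp add: indicator_def)
      then show ?case
        by (rule tendsto_eventually)
    qed
    show "AE x in M. norm ((norm (u x - indicat_real (A n) x *\<^sub>R u x))\<^sup>2) \<le> (norm (u x))\<^sup>2" for n
      by (auto simp: indicator_def)
    show "(\<lambda>x. (norm (u x - indicat_real (A n) x *\<^sub>R u x))\<^sup>2) \<in> borel_measurable M" for n
      using sq_int_diff[OF u sq_int_indicator[OF u A(1)], of n]
      by (auto simp: sq_int_def intro!: borel_measurable_power borel_measurable_norm)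
  qed simp
  then show ?thesis
    using tendsto_real_sqrt by (fastforce simp: l2_def)
qed

lemma sq_int_Pair:
  fixes u :: "'a \<Rightarrow> 'b::euclidean_space" and v :: "'a \<Rightarrow> 'c::euclidean_space"
  assumes "sq_int M u" "sq_int M v"
  shows "sq_int M (\<lambda>x. (u x, v x))"
    and "(l2 M (\<lambda>x. (u x, v x)))\<^sup>2 = (l2 M u)\<^sup>2 + (l2 M v)\<^sup>2"
proof -
  have [measurable]: "u \<in> borel_measurable M" "v \<in> borel_measurable M"
    using assms by (auto simp: sq_int_def)
  show "sq_int M (\<lambda>x. (u x, v x))"
    using assms by (auto simp: sq_int_def norm_Pair)
  show "(l2 M (\<lambda>x. (u x, v x)))\<^sup>2 = (l2 M u)\<^sup>2 + (l2 M v)\<^sup>2"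
    unfolding l2_power2 using assms by (simp add: sq_int_def norm_Pair)
qed

lemma
  fixes u :: "'a \<Rightarrow> 'b::euclidean_space \<times> 'c::euclidean_space"
  assumes "sq_int M u"
  shows sq_int_fst: "sq_int M (\<lambda>x. fst (u x))" and sq_int_snd: "sq_int M (\<lambda>x. snd (u x))"
proof -
  have [measurable]: "u \<in> borel_measurable M"
    using assms by (simp add: sq_int_def)
  have "(\<lambda>x. fst (u x)) \<in> borel_measurable M" "(\<lambda>x. snd (u x)) \<in> borel_measurable M"
    by (auto intro!: measurable_compose[OF \<open>u \<in> borel_measurable M\<close>]
        borel_measurable_continuous_onI continuous_intros)
  then show "sq_int M (\<lambda>x. fst (u x))" "sq_int M (\<lambda>x. snd (u x))"
    using norm_fst_le[of "fst (u x)" "snd (u x)" for x] norm_snd_le[of "snd (u x)" "fst (u x)" for x]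
    by (auto intro!: sq_int_bound[OF assms, where C=1] AE_I2)
qed

lemma l2_le:
  assumes "sq_int M u" "sq_int M v" "AE x in M. norm (v x) \<le> C * norm (u x)" "0 \<le> C"
  shows "l2 M v \<le> C * l2 M u"
proof (rule power2_le_imp_le)
  have "(LINT x|M. (norm (v x))\<^sup>2) \<le> (LINT x|M. C\<^sup>2 * (norm (u x))\<^sup>2)"
  proof (rule integral_mono_AE)
    show "AE x in M. (norm (v x))\<^sup>2 \<le> C\<^sup>2 * (norm (u x))\<^sup>2"
      using assms(3)
    proof eventually_elim
      case (elim x)
      then have "(norm (v x))\<^sup>2 \<le> (C * norm (u x))\<^sup>2"
        by (intro power_mono) auto
      then show ?case by (simp add: power_mult_distrib)
    qed
  qed (use assms in \<open>auto simp: sq_int_def\<close>)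
  then show "(l2 M v)\<^sup>2 \<le> (C * l2 M u)\<^sup>2"
    by (simp add: l2_power2 power_mult_distrib)
qed (use assms in simp)

text \<open>Write u = v + d and expand the square; Cauchy-Schwarz controls the cross term. This
  makes the squared seminorm continuous.\<close>

lemma l2_power2_diff_le:
  assumes u: "sq_int M u" and v: "sq_int M v"
  shows "\<bar>(l2 M u)\<^sup>2 - (l2 M v)\<^sup>2\<bar> \<le> 2 * l2 M v * l2 M (\<lambda>x. u x - v x) + (l2 M (\<lambda>x. u x - v x))\<^sup>2"
proof -
  let ?d = "\<lambda>x. u x - v x"
  have d: "sq_int M ?d"
    using u v by (rule sq_int_diff)
  have "(l2 M u)\<^sup>2 = (LINT x|M. (norm (v x))\<^sup>2 + 2 * (v x \<bullet> ?d x) + (norm (?d x))\<^sup>2)"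
    unfolding l2_power2
    by (rule Bochner_Integration.integral_cong)
      (simp_all add: power2_norm_eq_inner inner_diff inner_commute)
  also have "\<dots> = (l2 M v)\<^sup>2 + 2 * (LINT x|M. v x \<bullet> ?d x) + (l2 M ?d)\<^sup>2"
    unfolding l2_power2 using v d sq_int_integrable_inner[OF v d] by (simp add: sq_int_def)
  finally have eq: "(l2 M u)\<^sup>2 - (l2 M v)\<^sup>2 = 2 * (LINT x|M. v x \<bullet> ?d x) + (l2 M ?d)\<^sup>2"
    by simp
  show ?thesis
    unfolding eq using l2_Cauchy_Schwarz[OF v d] zero_le_power2[of "l2 M ?d"] by linarith
qed

lemma l2_power2_tendsto:
  assumes "\<forall>\<^sub>F i in F. sq_int M (u i)" "sq_int M v" "((\<lambda>i. l2 M (\<lambda>x. u i x - v x)) \<longlongrightarrow> 0) F"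
  shows "((\<lambda>i. (l2 M (u i))\<^sup>2) \<longlongrightarrow> (l2 M v)\<^sup>2) F"
proof (rule LIM_zero_cancel, rule Lim_null_comparison)
  show "\<forall>\<^sub>F i in F. norm ((l2 M (u i))\<^sup>2 - (l2 M v)\<^sup>2) \<le>
      2 * l2 M v * l2 M (\<lambda>x. u i x - v x) + (l2 M (\<lambda>x. u i x - v x))\<^sup>2"
    using assms(1) by eventually_elim (use assms(2) l2_power2_diff_le in auto)
  show "((\<lambda>i. 2 * l2 M v * l2 M (\<lambda>x. u i x - v x) + (l2 M (\<lambda>x. u i x - v x))\<^sup>2) \<longlongrightarrow> 0) F"
    using assms(3) by (auto intro!: tendsto_eq_intros)
qed

text \<open>The squared norms tend to 0 in L1, and L1 convergence gives almost everywhere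
  convergence along a subsequence.\<close>

lemma l2_tendsto_AE_subseq:
  assumes "\<And>n. sq_int M (X n)" "(\<lambda>n. l2 M (X n)) \<longlonglongrightarrow> 0"
  shows "\<exists>r. strict_mono r \<and> (AE x in M. (\<lambda>n. X (r n) x) \<longlonglongrightarrow> 0)"
proof -
  have "(\<lambda>n. (l2 M (X n))\<^sup>2) \<longlonglongrightarrow> 0\<^sup>2"
    by (intro tendsto_intros assms)
  then have "(\<lambda>n. LINT x|M. norm ((norm (X n x))\<^sup>2)) \<longlonglongrightarrow> 0"
    by (simp add: l2_power2)
  then obtain r where r: "strict_mono r" "AE x in M. (\<lambda>n. (norm (X (r n) x))\<^sup>2) \<longlonglongrightarrow> 0"
    using tendsto_L1_AE_subseq[of M "\<lambda>n x. (norm (X n x))\<^sup>2"] assms(1) by (auto simp: sq_int_def)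
  from r(2) have "AE x in M. (\<lambda>n. X (r n) x) \<longlonglongrightarrow> 0"
  proof eventually_elim
    case (elim x)
    then show ?case
      using tendsto_real_sqrt[OF elim] by (simp add: tendsto_norm_zero_iff)
  qed
  with r(1) show ?thesis by blast
qed

lemma nn_integral_finite_iff_integrable:
  fixes f :: "'a \<Rightarrow> real"
  assumes "f \<in> borel_measurable M" "AE x in M. 0 \<le> f x"
  shows "(\<integral>\<^sup>+x. ennreal (f x) \<partial>M) < \<infinity> \<longleftrightarrow> integrable M f"
  using assms integrableI_nonneg[OF assms] nn_integral_eq_integral[of M f] by auto

text \<open>Fatou's lemma for the squared distances from a fixed \<open>Y\<close>. It carries a
  Lipschitz estimate over to an end point at which only almost everywhere convergence is
  known.\<close>

lemma sq_int_Fatou: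
  assumes X: "\<And>n. sq_int M (X n)" and Y: "sq_int M Y" and X0: "X0 \<in> borel_measurable M"
    and lim: "AE x in M. (\<lambda>n. X n x) \<longlonglongrightarrow> X0 x"
    and bound: "\<And>n. l2 M (\<lambda>x. Y x - X n x) \<le> c n" "c \<longlonglongrightarrow> C"
  shows "sq_int M X0" and "l2 M (\<lambda>x. Y x - X0 x) \<le> C"
proof -
  let ?d = "\<lambda>Z x. (norm (Y x - Z x))\<^sup>2"
  have C: "0 \<le> C"
    using bound by (intro LIMSEQ_le_const[OF bound(2)]) (auto intro: order_trans[OF l2_nonneg])
  have [measurable]: "Y \<in> borel_measurable M" "\<And>n. X n \<in> borel_measurable M"
      "X0 \<in> borel_measurable M"
    using X Y X0 by (auto simp: sq_int_def)
  have "(\<integral>\<^sup>+x. ennreal (?d X0 x) \<partial>M) = (\<integral>\<^sup>+x. liminf (\<lambda>n. ennreal (?d (X n) x)) \<partial>M)"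
  proof (rule nn_integral_cong_AE)
    show "AE x in M. ennreal (?d X0 x) = liminf (\<lambda>n. ennreal (?d (X n) x))"
      using lim
    proof eventually_elim
      case (elim x)
      then have "(\<lambda>n. ennreal (?d (X n) x)) \<longlonglongrightarrow> ennreal (?d X0 x)"
        by (intro tendsto_intros)
      then show ?case
        using lim_imp_Liminf[OF sequentially_bot] by metis
    qed
  qed
  also have "\<dots> \<le> liminf (\<lambda>n. \<integral>\<^sup>+x. ennreal (?d (X n) x) \<partial>M)"
    by (rule nn_integral_liminf) measurable
  also have "\<dots> \<le> liminf (\<lambda>n. ennreal ((c n)\<^sup>2))"
  proof (rule Liminf_mono, rule always_eventually, rule allI)
    fix n
    have "(\<integral>\<^sup>+x. ennreal (?d (X n) x) \<partial>M) = ennreal ((l2 M (\<lambda>x. Y x - X n x))\<^sup>2)"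
      unfolding l2_power2 using sq_int_diff[OF Y X[of n]]
      by (intro nn_integral_eq_integral) (auto simp: sq_int_def)
    also have "\<dots> \<le> ennreal ((c n)\<^sup>2)"
      using bound(1)[of n] by (intro ennreal_leI power_mono) auto
    finally show "(\<integral>\<^sup>+x. ennreal (?d (X n) x) \<partial>M) \<le> ennreal ((c n)\<^sup>2)" .
  qed
  also have "\<dots> = ennreal (C\<^sup>2)"
    by (intro lim_imp_Liminf tendsto_intros bound(2)) simp
  finally have le: "(\<integral>\<^sup>+x. ennreal (?d X0 x) \<partial>M) \<le> ennreal (C\<^sup>2)" .
  then have int: "integrable M (?d X0)"
    by (subst nn_integral_finite_iff_integrable[symmetric]) (auto intro: le_less_trans)
  then have d: "sq_int M (\<lambda>x. Y x - X0 x)"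
    by (simp add: sq_int_def)
  \<comment> \<open>\<open>X0\<close> is recovered as \<open>Y\<close> minus the difference
    \<open>Y - X0\<close>, both square integrable.\<close>
  show "sq_int M X0"
    using sq_int_diff[OF Y d] by simp
  have "ennreal ((l2 M (\<lambda>x. Y x - X0 x))\<^sup>2) \<le> ennreal (C\<^sup>2)"
    using le unfolding l2_power2 by (subst (asm) nn_integral_eq_integral[OF int]) auto
  then show "l2 M (\<lambda>x. Y x - X0 x) \<le> C"
    using C by (simp add: power_mono_iff)
qed

section \<open>Weak derivatives of curves of square integrable functions\<close>

text \<open>
  Testing only against truncations of square integrable functions lets the derivative of products
  with unbounded weights, and of squares, be computed before their square integrability is used.
\<close>

locale weakly_differentiable_curve =
  fixes M :: "'a measure" and a b B :: real and Z Z' :: "real \<Rightarrow> 'a \<Rightarrow> 'b::euclidean_space"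
  assumes sq_int_Z: "t \<in> {a<..<b} \<Longrightarrow> sq_int M (Z t)"
    and sq_int_Z': "t \<in> {a<..<b} \<Longrightarrow> sq_int M (Z' t)"
    and l2_Z': "t \<in> {a<..<b} \<Longrightarrow> l2 M (Z' t) \<le> B"
    and truncated_derivative: "sq_int M \<psi> \<Longrightarrow>
      \<exists>A :: nat \<Rightarrow> 'a set. (\<forall>n. A n \<in> sets M) \<and> (AE x in M. \<forall>\<^sub>F n in sequentially. x \<in> A n) \<and>
        (\<forall>n. \<forall>t\<in>{a<..<b}.
          ((\<lambda>s. LINT x|M. Z s x \<bullet> (indicat_real (A n) x *\<^sub>R \<psi> x)) has_real_derivative
            (LINT x|M. Z' t x \<bullet> (indicat_real (A n) x *\<^sub>R \<psi> x))) (at t))"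
begin

text \<open>Testing with a truncated \<open>\<psi>\<close> leaves a scalar differentiable function,
  to which the mean value theorem applies. The bound is uniform in the truncation, which is then
  removed by a limit.\<close>

lemma inner_increment_le:
  assumes "s \<in> {a<..<b}" "t \<in> {a<..<b}" and \<psi>: "sq_int M \<psi>"
  shows "\<bar>LINT x|M. (Z s x - Z t x) \<bullet> \<psi> x\<bar> \<le> B * \<bar>s - t\<bar> * l2 M \<psi>"
  using assms(1,2)
proof (induction t s rule: linorder_wlog)
  case (le t s)
  show ?case
  proof (cases "s = t")
    case True
    then show ?thesis by simp
  next
    case False
    with le have st: "t < s" by simp
    define d where "d x = Z s x - Z t x" for x
    have d: "sq_int M d"
      unfolding d_def using le sq_int_Z by (intro sq_int_diff) auto
    obtain A :: "nat \<Rightarrow> 'a set" where A: "\<And>n. A n \<in> sets M"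
        "AE x in M. \<forall>\<^sub>F n in sequentially. x \<in> A n"
      and A': "\<And>n r. r \<in> {a<..<b} \<Longrightarrow>
          ((\<lambda>s. LINT x|M. Z s x \<bullet> (indicat_real (A n) x *\<^sub>R \<psi> x)) has_real_derivative
            (LINT x|M. Z' r x \<bullet> (indicat_real (A n) x *\<^sub>R \<psi> x))) (at r)"
      using truncated_derivative[OF \<psi>] by blast
    define \<psi>n where "\<psi>n n x = indicat_real (A n) x *\<^sub>R \<psi> x" for n x
    have \<psi>n: "sq_int M (\<psi>n n)" for n
      unfolding \<psi>n_def using \<psi> A(1) by (rule sq_int_indicator)
    have \<psi>n_le: "l2 M (\<psi>n n) \<le> l2 M \<psi>" for n
      unfolding \<psi>n_def using \<psi> A(1) by (rule l2_indicator_le)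
    have bnd: "\<bar>LINT x|M. d x \<bullet> \<psi>n n x\<bar> \<le> B * \<bar>s - t\<bar> * l2 M \<psi>" for n
    proof -
      have "\<exists>z. t < z \<and> z < s \<and> (LINT x|M. Z s x \<bullet> \<psi>n n x) - (LINT x|M. Z t x \<bullet> \<psi>n n x)
          = (s - t) * (LINT x|M. Z' z x \<bullet> \<psi>n n x)"
        using le by (intro MVT2[OF st]) (use A'[of _ n] in \<open>auto simp: \<psi>n_def simp del: inner_scaleR_right\<close>)
      then obtain z where z: "t < z" "z < s"
        and eq: "(LINT x|M. Z s x \<bullet> \<psi>n n x) - (LINT x|M. Z t x \<bullet> \<psi>n n x)
          = (s - t) * (LINT x|M. Z' z x \<bullet> \<psi>n n x)"
        by blast
      have zI: "z \<in> {a<..<b}" using z le by auto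
      have "(LINT x|M. d x \<bullet> \<psi>n n x) = (s - t) * (LINT x|M. Z' z x \<bullet> \<psi>n n x)"
        using le \<psi>n[of n] sq_int_Z unfolding eq[symmetric] d_def inner_diff_left
        by (intro Bochner_Integration.integral_diff sq_int_integrable_inner) auto
      also have "\<bar>\<dots>\<bar> \<le> \<bar>s - t\<bar> * (l2 M (Z' z) * l2 M (\<psi>n n))"
        unfolding abs_mult using l2_Cauchy_Schwarz[OF sq_int_Z'[OF zI] \<psi>n[of n]]
        by (intro mult_left_mono) auto
      also have "\<dots> \<le> \<bar>s - t\<bar> * (B * l2 M \<psi>)"
        using l2_Z'[OF zI] \<psi>n_le[of n] order_trans[OF l2_nonneg l2_Z'[OF zI]]
        by (intro mult_left_mono mult_mono) auto
      finally show ?thesis by (simp add: ac_simps)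
    qed
    \<comment> \<open>Replacing \<open>\<psi>\<close> by its truncation costs at most the norm of
      \<open>d\<close> times the norm of the part cut off, and the latter vanishes in the
      limit.\<close>
    have "\<bar>LINT x|M. d x \<bullet> \<psi> x\<bar> \<le> B * \<bar>s - t\<bar> * l2 M \<psi> + l2 M d * l2 M (\<lambda>x. \<psi> x - \<psi>n n x)" for n
    proof -
      have "(LINT x|M. d x \<bullet> \<psi> x) = (LINT x|M. d x \<bullet> \<psi>n n x) + (LINT x|M. d x \<bullet> (\<psi> x - \<psi>n n x))"
        using sq_int_integrable_inner[OF d \<psi>] sq_int_integrable_inner[OF d \<psi>n[of n]]
        by (simp add: inner_diff_right)
      then show ?thesis
        using bnd[of n] l2_Cauchy_Schwarz[OF d sq_int_diff[OF \<psi> \<psi>n[of n]]] by linarith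
    qed
    moreover have "(\<lambda>n. B * \<bar>s - t\<bar> * l2 M \<psi> + l2 M d * l2 M (\<lambda>x. \<psi> x - \<psi>n n x))
        \<longlonglongrightarrow> B * \<bar>s - t\<bar> * l2 M \<psi> + l2 M d * 0"
      unfolding \<psi>n_def by (intro tendsto_intros l2_indicator_tendsto \<psi> A)
    ultimately show ?thesis
      unfolding d_def by (intro LIMSEQ_le_const) auto
  qed
next
  case (sym t s)
  have "(LINT x|M. (Z t x - Z s x) \<bullet> \<psi> x) = - (LINT x|M. (Z s x - Z t x) \<bullet> \<psi> x)"
    unfolding Bochner_Integration.integral_minus[symmetric]
    by (rule Bochner_Integration.integral_cong) (simp_all add: inner_diff_left)
  then show ?case using sym by (simp add: abs_minus_commute)
qed

text \<open>Duality: the increment serves as its own test function, and one factor of its norm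
  cancels.\<close>

lemma l2_increment_le:
  assumes "s \<in> {a<..<b}" "t \<in> {a<..<b}"
  shows "l2 M (\<lambda>x. Z s x - Z t x) \<le> B * \<bar>s - t\<bar>"
proof -
  let ?d = "l2 M (\<lambda>x. Z s x - Z t x)"
  have B: "0 \<le> B"
    using l2_Z'[OF assms(1)] l2_nonneg order_trans by blast
  have "\<bar>LINT x|M. (Z s x - Z t x) \<bullet> (Z s x - Z t x)\<bar> \<le> B * \<bar>s - t\<bar> * ?d"
    using assms sq_int_Z by (intro inner_increment_le sq_int_diff) auto
  then have "?d * ?d \<le> B * \<bar>s - t\<bar> * ?d"
    by (simp add: l2_power2 power2_norm_eq_inner flip: power2_eq_square)
  then show ?thesis
    using B l2_nonneg[of M "\<lambda>x. Z s x - Z t x"]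
    by (cases "?d = 0") auto
qed

text \<open>By the Lipschitz bound, the difference quotients of the truncated pairings approach
  those of the full pairing uniformly in \<open>s\<close>, so the limits in \<open>s\<close> and in
  the truncation may be interchanged.\<close>

lemma has_real_derivative_inner:
  assumes t: "t \<in> {a<..<b}" and \<psi>: "sq_int M \<psi>"
  shows "((\<lambda>s. LINT x|M. Z s x \<bullet> \<psi> x) has_real_derivative (LINT x|M. Z' t x \<bullet> \<psi> x)) (at t)"
proof -
  obtain A :: "nat \<Rightarrow> 'a set" where A: "\<And>n. A n \<in> sets M"
      "AE x in M. \<forall>\<^sub>F n in sequentially. x \<in> A n"
    and A': "\<And>n r. r \<in> {a<..<b} \<Longrightarrow>
        ((\<lambda>s. LINT x|M. Z s x \<bullet> (indicat_real (A n) x *\<^sub>R \<psi> x)) has_real_derivative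
          (LINT x|M. Z' r x \<bullet> (indicat_real (A n) x *\<^sub>R \<psi> x))) (at r)"
    using truncated_derivative[OF \<psi>] by blast
  define \<psi>n where "\<psi>n n x = indicat_real (A n) x *\<^sub>R \<psi> x" for n x
  have \<psi>n: "sq_int M (\<psi>n n)" for n
    unfolding \<psi>n_def using \<psi> A(1) by (rule sq_int_indicator)
  define Q where "Q s = ((LINT x|M. Z s x \<bullet> \<psi> x) - (LINT x|M. Z t x \<bullet> \<psi> x)) / (s - t)" for s
  define Qn where
    "Qn n s = ((LINT x|M. Z s x \<bullet> \<psi>n n x) - (LINT x|M. Z t x \<bullet> \<psi>n n x)) / (s - t)" for n s
  have split: "(LINT x|M. u x \<bullet> \<psi> x) = (LINT x|M. u x \<bullet> \<psi>n n x) + (LINT x|M. u x \<bullet> (\<psi> x - \<psi>n n x))"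
    if "sq_int M u" for u n
    using sq_int_integrable_inner[OF that \<psi>] sq_int_integrable_inner[OF that \<psi>n[of n]]
    by (simp add: inner_diff_right)
  have Qdiff: "\<bar>Q s - Qn n s\<bar> \<le> B * l2 M (\<lambda>x. \<psi> x - \<psi>n n x)" if s: "s \<in> {a<..<b}" "s \<noteq> t" for s n
  proof -
    have "Q s - Qn n s = (LINT x|M. (Z s x - Z t x) \<bullet> (\<psi> x - \<psi>n n x)) / (s - t)"
      using sq_int_integrable_inner[OF sq_int_Z[OF s(1)] sq_int_diff[OF \<psi> \<psi>n[of n]]]
        sq_int_integrable_inner[OF sq_int_Z[OF t] sq_int_diff[OF \<psi> \<psi>n[of n]]]
      unfolding Q_def Qn_def split[OF sq_int_Z[OF s(1)], of n] split[OF sq_int_Z[OF t], of n]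
      by (simp add: inner_diff_left diff_divide_distrib add_divide_distrib)
    also have "\<bar>\<dots>\<bar> \<le> (B * \<bar>s - t\<bar> * l2 M (\<lambda>x. \<psi> x - \<psi>n n x)) / \<bar>s - t\<bar>"
      unfolding abs_divide
      by (intro divide_right_mono inner_increment_le sq_int_diff \<psi> \<psi>n t s) simp
    also have "\<dots> = B * l2 M (\<lambda>x. \<psi> x - \<psi>n n x)"
      using s by simp
    finally show ?thesis .
  qed
  have Ddiff: "\<bar>(LINT x|M. Z' t x \<bullet> \<psi> x) - (LINT x|M. Z' t x \<bullet> \<psi>n n x)\<bar>
      \<le> B * l2 M (\<lambda>x. \<psi> x - \<psi>n n x)" for n
    using split[OF sq_int_Z'[OF t], of n] mult_right_mono[OF l2_Z'[OF t] l2_nonneg, of M "\<lambda>x. \<psi> x - \<psi>n n x"]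
      l2_Cauchy_Schwarz[OF sq_int_Z'[OF t] sq_int_diff[OF \<psi> \<psi>n[of n]]]
    by linarith
  have "(Q \<longlongrightarrow> (LINT x|M. Z' t x \<bullet> \<psi> x)) (at t)"
  proof (rule tendstoI)
    fix e :: real
    assume e: "0 < e"
    have "(\<lambda>n. B * l2 M (\<lambda>x. \<psi> x - \<psi>n n x)) \<longlonglongrightarrow> B * 0"
      unfolding \<psi>n_def by (intro tendsto_intros l2_indicator_tendsto \<psi> A)
    then have "\<forall>\<^sub>F n in sequentially. B * l2 M (\<lambda>x. \<psi> x - \<psi>n n x) < e / 3"
      by (rule order_tendstoD) (use e in simp)
    \<comment> \<open>This single \<open>n\<close> controls the truncation error of the quotients
      and of the derivative, independently of \<open>s\<close>.\<close>
    then obtain n where n: "B * l2 M (\<lambda>x. \<psi> x - \<psi>n n x) < e / 3"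
      by (auto simp: eventually_sequentially)
    have "(Qn n \<longlongrightarrow> (LINT x|M. Z' t x \<bullet> \<psi>n n x)) (at t)"
      using A'[OF t, of n] unfolding Qn_def \<psi>n_def has_field_derivative_iff by simp
    then have "\<forall>\<^sub>F s in at t. dist (Qn n s) (LINT x|M. Z' t x \<bullet> \<psi>n n x) < e / 3"
      by (rule tendstoD) (use e in simp)
    moreover have "\<forall>\<^sub>F s in at t. s \<in> {a<..<b}"
      using t by (intro eventually_at_in_open') auto
    moreover have "\<forall>\<^sub>F s in at t. s \<noteq> t"
      by (simp add: eventually_at_filter)
    ultimately show "\<forall>\<^sub>F s in at t. dist (Q s) (LINT x|M. Z' t x \<bullet> \<psi> x) < e"
    proof eventually_elim
      case (elim s)
      then show ?case
        using Qdiff[of s n] Ddiff[of n] n unfolding dist_real_def by linarith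
    qed
  qed
  then show ?thesis
    by (simp add: has_field_derivative_iff Q_def[abs_def])
qed

text \<open>The weighted square is expanded about \<open>Z t\<close>. The part linear in
  \<open>Z s\<close> is differentiated weakly, and the Lipschitz bound makes the part quadratic in
  the increment negligible.\<close>

lemma has_real_derivative_weighted_norm:
  assumes t: "t \<in> {a<..<b}" and \<phi>: "\<phi> \<in> borel_measurable M" "\<And>x. x \<in> space M \<Longrightarrow> \<bar>\<phi> x\<bar> \<le> C"
  shows "((\<lambda>s. LINT x|M. \<phi> x * (norm (Z s x))\<^sup>2) has_real_derivative
    2 * (LINT x|M. \<phi> x * (Z t x \<bullet> Z' t x))) (at t)"
proof -
  have \<phi>sq: "sq_int M (\<lambda>x. \<phi> x *\<^sub>R u x)" if "sq_int M u" for u :: "'a \<Rightarrow> 'b"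
    by (rule sq_int_bound[OF that, where C=C])
      (use that \<phi> in \<open>auto simp: sq_int_def intro!: AE_I2 mult_right_mono\<close>)
  \<comment> \<open>From |a|^2 = 2 a . b + |a - b|^2 - |b|^2 with a = \<open>Z s x\<close> and b =
    \<open>Z t x\<close>, the weighted integral equals \<open>2 * p s + q s - p t\<close>.\<close>
  define p where "p s = (LINT x|M. Z s x \<bullet> (\<phi> x *\<^sub>R Z t x))" for s
  define q where "q s = (LINT x|M. (Z s x - Z t x) \<bullet> (\<phi> x *\<^sub>R (Z s x - Z t x)))" for s
  have p: "(p has_real_derivative (LINT x|M. Z' t x \<bullet> (\<phi> x *\<^sub>R Z t x))) (at t)"
    unfolding p_def by (intro has_real_derivative_inner t \<phi>sq sq_int_Z)
  have near: "\<forall>\<^sub>F s in nhds t. s \<in> {a<..<b}"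
    using t by (intro eventually_nhds_in_open) auto
  have q_le: "\<bar>q s\<bar> \<le> \<bar>C\<bar> * B\<^sup>2 * (s - t)\<^sup>2" if s: "s \<in> {a<..<b}" for s
  proof -
    let ?d = "\<lambda>x. Z s x - Z t x"
    have d: "sq_int M ?d"
      by (intro sq_int_diff sq_int_Z t s)
    have "l2 M (\<lambda>x. \<phi> x *\<^sub>R ?d x) \<le> l2 M (\<lambda>x. C *\<^sub>R ?d x)"
      unfolding l2_def
    proof (intro real_sqrt_le_mono integral_mono)
      fix x assume "x \<in> space M"
      with \<phi>(2) have "\<bar>\<phi> x\<bar> \<le> \<bar>C\<bar>"
        by fastforce
      then show "(norm (\<phi> x *\<^sub>R ?d x))\<^sup>2 \<le> (norm (C *\<^sub>R ?d x))\<^sup>2"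
        by (auto intro!: power_mono mult_right_mono)
    qed (use \<phi>sq[OF d] sq_int_scaleR[OF d, of C] in \<open>simp_all add: sq_int_def\<close>)
    then have l: "l2 M (\<lambda>x. \<phi> x *\<^sub>R ?d x) \<le> \<bar>C\<bar> * l2 M ?d"
      by (simp add: l2_scaleR)
    have "\<bar>q s\<bar> \<le> l2 M ?d * l2 M (\<lambda>x. \<phi> x *\<^sub>R ?d x)"
      unfolding q_def by (intro l2_Cauchy_Schwarz d \<phi>sq)
    also have "\<dots> \<le> l2 M ?d * (\<bar>C\<bar> * l2 M ?d)"
      by (intro mult_left_mono l) simp
    also have "\<dots> = \<bar>C\<bar> * (l2 M ?d)\<^sup>2"
      by (simp add: power2_eq_square)
    also have "\<dots> \<le> \<bar>C\<bar> * (B * \<bar>s - t\<bar>)\<^sup>2"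
      by (intro mult_left_mono power_mono l2_increment_le t s) auto
    finally show ?thesis
      by (simp add: power_mult_distrib)
  qed
  \<comment> \<open>\<open>q t\<close> is 0 and \<open>q s\<close> is of order (s - t)^2.\<close>
  have q: "(q has_real_derivative 0) (at t)"
    unfolding has_field_derivative_iff
  proof (rule Lim_null_comparison)
    show "\<forall>\<^sub>F s in at t. norm ((q s - q t) / (s - t)) \<le> \<bar>C\<bar> * B\<^sup>2 * \<bar>s - t\<bar>"
      using eventually_nhds_conv_at[THEN iffD1, OF near, THEN conjunct1]
      by eventually_elim
        (use q_le in \<open>force simp: q_def divide_simps power2_eq_square abs_mult_self_eq mult.assoc\<close>)
    show "((\<lambda>s. \<bar>C\<bar> * B\<^sup>2 * \<bar>s - t\<bar>) \<longlongrightarrow> 0) (at t)"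
      by (auto intro!: tendsto_eq_intros)
  qed
  have "((\<lambda>s. 2 * p s + q s - p t) has_real_derivative
      2 * (LINT x|M. Z' t x \<bullet> (\<phi> x *\<^sub>R Z t x))) (at t)"
    by (auto intro!: derivative_eq_intros p q)
  moreover have "\<forall>\<^sub>F s in nhds t. 2 * p s + q s - p t = (LINT x|M. \<phi> x * (norm (Z s x))\<^sup>2)"
    using near
  proof eventually_elim
    case (elim s)
    note i = sq_int_integrable_inner[OF sq_int_Z[OF elim] \<phi>sq[OF sq_int_Z[OF t]]]
      sq_int_integrable_inner[OF sq_int_Z[OF t] \<phi>sq[OF sq_int_Z[OF t]]]
      sq_int_integrable_inner[OF sq_int_diff[OF sq_int_Z[OF elim] sq_int_Z[OF t]]
        \<phi>sq[OF sq_int_diff[OF sq_int_Z[OF elim] sq_int_Z[OF t]]]]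
    have "2 * p s + q s - p t = (LINT x|M. 2 * (Z s x \<bullet> (\<phi> x *\<^sub>R Z t x))
        + (Z s x - Z t x) \<bullet> (\<phi> x *\<^sub>R (Z s x - Z t x)) - Z t x \<bullet> (\<phi> x *\<^sub>R Z t x))"
      unfolding p_def q_def using i by simp
    also have "\<dots> = (LINT x|M. \<phi> x * (norm (Z s x))\<^sup>2)"
      by (rule Bochner_Integration.integral_cong)
        (auto simp: power2_norm_eq_inner inner_diff inner_commute algebra_simps)
    finally show ?case .
  qed
  ultimately have "((\<lambda>s. LINT x|M. \<phi> x * (norm (Z s x))\<^sup>2) has_real_derivative
      2 * (LINT x|M. Z' t x \<bullet> (\<phi> x *\<^sub>R Z t x))) (at t)"
    by (simp add: DERIV_cong_ev)
  then show ?thesis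
    by (simp add: inner_commute)
qed

end

section \<open>A growth estimate through the square root\<close>

text \<open>Formally the root of \<open>f\<close> has a derivative of size at most sqrt N.
  Integrating it against the constant 1 over an interval of length t, Cauchy-Schwarz gives sqrt (f
  t) \<le> sqrt (f 0) + sqrt (G t).\<close>

lemma sqrt_growth:
  fixes f f' N :: "real \<Rightarrow> real"
  assumes t: "0 < t" and cont: "continuous_on {0..t} f" and f: "\<And>s. s \<in> {0..t} \<Longrightarrow> 0 \<le> f s"
    and deriv: "\<And>s. s \<in> {0<..<t} \<Longrightarrow> (f has_real_derivative f' s) (at s)"
    and f'_le: "\<And>s. s \<in> {0<..<t} \<Longrightarrow> \<bar>f' s\<bar> \<le> 2 * sqrt (N s) * sqrt (f s)"
    and N: "\<And>s. s \<in> {0<..<t} \<Longrightarrow> 0 \<le> N s"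
    and G: "(\<integral>\<^sup>+s. ennreal (N s) \<partial>lebesgue_on {0<..<t}) \<le> ennreal G" "0 \<le> G"
  shows "f t \<le> 2 * f 0 + 2 * t * G"
proof (rule field_le_epsilon)
  fix e :: real
  assume e: "0 < e"
  \<comment> \<open>The shift by \<open>e\<close> keeps the root differentiable where \<open>f\<close> vanishes.\<close>
  define h h' where "h s = sqrt (f s + e)" and "h' s = f' s / (2 * sqrt (f s + e))" for s
  let ?M = "lebesgue_on {0<..<t}"
  have "(h has_real_derivative h' s) (at s)" if "s \<in> {0<..<t}" for s
    unfolding h_def h'_def using f[of s] that e
    by (auto intro!: derivative_eq_intros deriv simp: field_simps)
  \<comment> \<open>Only pointwise derivatives are at hand, so the fundamental theorem is used for
    the gauge integral. It also yields the measurability of \<open>h'\<close>; Lebesgue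
    integrability then follows from the bound by \<open>N\<close>.\<close>
  then have "(h' has_integral h t - h 0) {0..t}"
    using t cont unfolding h_def
    by (intro fundamental_theorem_of_calculus_interior continuous_intros)
      (auto simp: has_real_derivative_iff_has_vector_derivative)
  then have h'_int: "(h' has_integral h t - h 0) {0<..<t}"
    using has_integral_open_interval[of h' "h t - h 0" 0 t] by (simp add: box_real)
  have h'_meas: "h' \<in> borel_measurable ?M"
    using h'_int by (intro integrable_imp_measurable) (auto simp: integrable_on_def)
  have h'_le: "(h' s)\<^sup>2 \<le> N s" if s: "s \<in> {0<..<t}" for s
  proof -
    have "\<bar>f' s\<bar> \<le> 2 * sqrt (N s) * sqrt (f s + e)"
      using N[OF s] e by (intro order_trans[OF f'_le[OF s]] mult_left_mono) auto
    then have "\<bar>h' s\<bar> \<le> sqrt (N s)"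
      using f[of s] s e by (auto simp: h'_def abs_mult field_simps)
    then show ?thesis
      using N[OF s] by (metis abs_le_square_iff abs_of_nonneg real_sqrt_ge_zero real_sqrt_pow2)
  qed
  have "(\<integral>\<^sup>+s. ennreal ((norm (h' s))\<^sup>2) \<partial>?M) \<le> (\<integral>\<^sup>+s. ennreal (N s) \<partial>?M)"
    using h'_le by (intro nn_integral_mono ennreal_leI) auto
  also note G(1)
  finally have le: "(\<integral>\<^sup>+s. ennreal ((norm (h' s))\<^sup>2) \<partial>?M) \<le> ennreal G" .
  then have int: "integrable ?M (\<lambda>s. (norm (h' s))\<^sup>2)"
    using h'_meas by (subst nn_integral_finite_iff_integrable[symmetric]) (auto intro: le_less_trans)
  have sq: "sq_int ?M h'"
    using int h'_meas by (simp add: sq_int_def)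
  have sq1: "sq_int ?M (\<lambda>_. 1::real)"
    using finite_measure.integrable_const[OF finite_measure_lebesgue_on, of "{0<..<t}" "1::real"]
    by (simp add: sq_int_def lmeasurable_box flip: box_real)
  have "ennreal ((l2 ?M h')\<^sup>2) \<le> ennreal G"
    using le unfolding l2_power2 by (subst (asm) nn_integral_eq_integral[OF int]) auto
  then have "l2 ?M h' \<le> sqrt G"
    using G(2) by (simp add: real_le_rsqrt)
  moreover have "l2 ?M (\<lambda>_. 1::real) = sqrt t"
    using t by (simp add: l2_def measure_restrict_space)
  ultimately have "\<bar>LINT s|?M. h' s \<bullet> 1\<bar> \<le> sqrt G * sqrt t"
    using l2_Cauchy_Schwarz[OF sq sq1] t
    by (auto elim!: order_trans intro!: mult_right_mono)
  moreover have "(LINT s|?M. h' s) = h t - h 0"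
    using has_integral_integral_lebesgue_on[of "{0<..<t}" h'] sq_int_integrable_inner[OF sq sq1] h'_int
    by (auto dest: has_integral_unique)
  ultimately have "h t \<le> h 0 + sqrt (G * t)"
    by (simp add: real_sqrt_mult)
  moreover have "0 \<le> h t"
    using f[of t] t e by (simp add: h_def)
  ultimately have "(h t)\<^sup>2 \<le> (h 0 + sqrt (G * t))\<^sup>2"
    by (intro power_mono) auto
  also have "\<dots> \<le> 2 * (h 0)\<^sup>2 + 2 * (sqrt (G * t))\<^sup>2"
    using sum_squares_bound[of "h 0" "sqrt (G * t)"] by (simp add: power2_sum)
  \<comment> \<open>The square of \<open>h t\<close> contributes one \<open>e\<close> on the left
    and twice the square of \<open>h 0\<close> contributes 2e on the right, so exactly one
    \<open>e\<close> remains.\<close>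
  finally show "f t \<le> 2 * f 0 + 2 * t * G + e"
    using f[of t] f[of 0] t e G(2) by (simp add: h_def ac_simps)
qed

section \<open>Weighted norms as plain norms of scaled fields\<close>

text \<open>The root of the weight is moved into the field. Where \<open>w\<close> is negative the
  two sides would differ: \<open>ennreal\<close> truncates to 0, while the square of
  \<open>sqrt (w x)\<close> is the absolute value of \<open>w x\<close>.\<close>

lemma sqnorm_finite_iff:
  fixes u :: "real^3 \<Rightarrow> 'b::euclidean_space"
  assumes "w \<in> borel_measurable (lebesgue_on \<Omega>)" "AE x in lebesgue_on \<Omega>. 0 \<le> w x"
    "u \<in> borel_measurable (lebesgue_on \<Omega>)"
  shows "sqnorm \<Omega> w u < \<infinity> \<longleftrightarrow> sq_int (lebesgue_on \<Omega>) (\<lambda>x. sqrt (w x) *\<^sub>R u x)"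
proof -
  have "sqnorm \<Omega> w u = (\<integral>\<^sup>+x. ennreal ((norm (sqrt (w x) *\<^sub>R u x))\<^sup>2) \<partial>lebesgue_on \<Omega>)"
    unfolding sqnorm_def using assms(2)
    by (intro nn_integral_cong_AE) (auto simp: power_mult_distrib)
  moreover have "(\<lambda>x. sqrt (w x) *\<^sub>R u x) \<in> borel_measurable (lebesgue_on \<Omega>)"
    using assms by measurable
  moreover note measurable_compose[OF this borel_measurable_norm]
  then have "(\<integral>\<^sup>+x. ennreal ((norm (sqrt (w x) *\<^sub>R u x))\<^sup>2) \<partial>lebesgue_on \<Omega>) < \<infinity>
      \<longleftrightarrow> integrable (lebesgue_on \<Omega>) (\<lambda>x. (norm (sqrt (w x) *\<^sub>R u x))\<^sup>2)"
    by (rule nn_integral_finite_iff_integrable[OF borel_measurable_power]) simp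
  ultimately show ?thesis
    unfolding sq_int_def by simp
qed

lemma sqnorm_eq_l2:
  fixes u :: "real^3 \<Rightarrow> 'b::euclidean_space"
  assumes "AE x in lebesgue_on \<Omega>. 0 \<le> w x" "sq_int (lebesgue_on \<Omega>) (\<lambda>x. sqrt (w x) *\<^sub>R u x)"
  shows "sqnorm \<Omega> w u = ennreal ((l2 (lebesgue_on \<Omega>) (\<lambda>x. sqrt (w x) *\<^sub>R u x))\<^sup>2)"
proof -
  have "sqnorm \<Omega> w u = (\<integral>\<^sup>+x. ennreal ((norm (sqrt (w x) *\<^sub>R u x))\<^sup>2) \<partial>lebesgue_on \<Omega>)"
    unfolding sqnorm_def using assms(1)
    by (intro nn_integral_cong_AE) (auto simp: power_mult_distrib)
  then show ?thesis
    using assms(2) unfolding l2_power2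
    by (subst nn_integral_eq_integral[symmetric]) (auto simp: sq_int_def)
qed

lemma L2_iff_sq_int: "u \<in> L2 \<Omega> \<longleftrightarrow> sq_int (lebesgue_on \<Omega>) u" for u :: "real^3 \<Rightarrow> 'b::euclidean_space"
proof (cases "u \<in> borel_measurable (lebesgue_on \<Omega>)")
  case True
  then show ?thesis
    using sqnorm_finite_iff[of "\<lambda>_. 1" \<Omega> u] by (simp add: L2w_def)
next
  case False
  then show ?thesis
    by (simp add: L2w_def sq_int_def)
qed

lemma L2_sqnorm_eq_l2:
  fixes u :: "real^3 \<Rightarrow> 'b::euclidean_space"
  assumes "sq_int (lebesgue_on \<Omega>) u"
  shows "L2_sqnorm \<Omega> u = ennreal ((l2 (lebesgue_on \<Omega>) u)\<^sup>2)"
  using sqnorm_eq_l2[of "\<lambda>_. 1" \<Omega> u] assms by simp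

section \<open>The permittivity matrix and its square root\<close>

lemma outer_product_mult_vec: "(\<chi> i j. e $ i * e $ j) *v v = (e \<bullet> v) *\<^sub>R e" for e v :: "real^3"
  by (simp add: vec_eq_iff matrix_vector_mult_def inner_vec_def sum_distrib_left ac_simps)

lemma permittivity_mult_vec:
  "permittivity eps0 c1 c3 e *v v =
    eps0 *\<^sub>R ((1 + c1 + c3 * (norm e)\<^sup>2) *\<^sub>R v + (2 * c3 * (e \<bullet> v)) *\<^sub>R e)"
  by (simp add: permittivity_def scaleR_matrix_vector_assoc[symmetric]
      matrix_vector_mult_add_rdistrib outer_product_mult_vec)

text \<open>A multiple of the identity plus a multiple of \<open>e e\<^sup>T\<close> has a root of the same form.\<close>

lemma permittivity_sqrt_exists:
  assumes "0 < eps0" "0 \<le> c1" "0 \<le> c3"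
  shows "\<exists>B. transpose B = B \<and> (\<forall>v. 0 \<le> v \<bullet> (B *v v)) \<and> B ** B = permittivity eps0 c1 c3 e"
proof -
  define n where "n = (norm e)\<^sup>2"
  \<comment> \<open>\<open>p\<close> and \<open>r\<close> are the roots of the eigenvalues of the
    permittivity orthogonal to \<open>e\<close> and along \<open>e\<close>. The coefficient
    \<open>g\<close> is chosen so that p + g n = r; for e = 0 division by zero makes it 0.\<close>
  define p r g where "p = sqrt (eps0 * (1 + c1 + c3 * n))"
    and "r = sqrt (eps0 * (1 + c1 + 3 * c3 * n))" and "g = (r - p) / n"
  have n: "n = e \<bullet> e" "0 \<le> n"
    by (simp_all add: n_def power2_norm_eq_inner)
  have p: "p\<^sup>2 = eps0 * (1 + c1 + c3 * n)" "0 \<le> p"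
    using assms n by (auto simp: p_def)
  have r: "r\<^sup>2 = eps0 * (1 + c1 + 3 * c3 * n)"
    using assms n by (auto simp: r_def)
  have "p \<le> r"
    using assms n by (auto simp: p_def r_def intro!: mult_right_mono)
  then have g: "0 \<le> g"
    using n by (simp add: g_def)
  \<comment> \<open>This compares the coefficients of the outer product in the square of the root
    and in the permittivity. For e = 0 the outer product vanishes, and that case is settled
    separately below.\<close>
  have key: "2 * p * g + g\<^sup>2 * n = eps0 * (2 * c3)" if "e \<noteq> 0"
  proof -
    have n0: "0 < n" using that by (simp add: n_def)
    have gn: "g * n = r - p" using n0 by (simp add: g_def)
    have "(2 * p * g + g\<^sup>2 * n) * n = 2 * p * (g * n) + (g * n)\<^sup>2"
      by (simp add: power2_eq_square algebra_simps)
    also have "\<dots> = r\<^sup>2 - p\<^sup>2"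
      unfolding gn by (simp add: power2_eq_square algebra_simps)
    also have "\<dots> = eps0 * (2 * c3) * n"
      unfolding p r by (simp add: algebra_simps)
    finally show ?thesis using n0 by simp
  qed
  define B :: "real^3^3" where "B = p *\<^sub>R mat 1 + g *\<^sub>R (\<chi> i j. e $ i * e $ j)"
  have B: "B *v v = p *\<^sub>R v + (g * (e \<bullet> v)) *\<^sub>R e" for v
    by (simp add: B_def scaleR_matrix_vector_assoc[symmetric]
        matrix_vector_mult_add_rdistrib outer_product_mult_vec)
  have "transpose B = B"
    by (simp add: B_def transpose_def mat_def vec_eq_iff ac_simps)
  moreover have "0 \<le> v \<bullet> (B *v v)" for v
    using p(2) g by (simp add: B inner_add_right inner_commute[of v e] mult.assoc)
  moreover have "B ** B = permittivity eps0 c1 c3 e"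
    unfolding matrix_eq
  proof
    fix v
    have "(B ** B) *v v = p\<^sup>2 *\<^sub>R v + ((2 * p * g + g\<^sup>2 * n) * (e \<bullet> v)) *\<^sub>R e"
      by (simp add: matrix_vector_mul_assoc[symmetric] B inner_add_right n scaleR_add_right
          power2_eq_square vec_eq_iff) (simp add: algebra_simps)
    also have "\<dots> = permittivity eps0 c1 c3 e *v v"
      using key p by (cases "e = 0") (simp_all add: permittivity_mult_vec n_def algebra_simps)
    finally show "(B ** B) *v v = permittivity eps0 c1 c3 e *v v" .
  qed
  ultimately show ?thesis by blast
qed

text \<open>A symmetric root B satisfies |B v|^2 = v . (B B v), so the norm is the quadratic form of
  the permittivity itself, whatever root is selected.\<close>

lemma norm_psd_sqrt_permittivity:
  assumes "0 < eps0" "0 \<le> c1" "0 \<le> c3"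
  shows "(norm (psd_sqrt (permittivity eps0 c1 c3 e) *v v))\<^sup>2 =
    eps0 * ((1 + c1 + c3 * (norm e)\<^sup>2) * (norm v)\<^sup>2 + 2 * c3 * (e \<bullet> v)\<^sup>2)"
proof -
  let ?A = "permittivity eps0 c1 c3 e"
  let ?B = "psd_sqrt ?A"
  have "transpose ?B = ?B \<and> (\<forall>v. 0 \<le> v \<bullet> (?B *v v)) \<and> ?B ** ?B = ?A"
    unfolding psd_sqrt_def by (rule someI_ex) (rule permittivity_sqrt_exists[OF assms])
  then have B: "transpose ?B = ?B" "?B ** ?B = ?A"
    by auto
  have "(norm (?B *v v))\<^sup>2 = (transpose ?B *v v) \<bullet> (?B *v v)"
    by (simp add: B power2_norm_eq_inner)
  also have "\<dots> = v \<bullet> (?A *v v)"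
    unfolding transpose_matrix_vector dot_lmul_matrix matrix_vector_mul_assoc B(2) ..
  finally show ?thesis
    by (simp add: permittivity_mult_vec inner_add_right inner_commute[of v e] dot_square_norm
        power2_eq_square[of "e \<bullet> v"] algebra_simps)
qed

section \<open>Continuously differentiable curves are weakly differentiable\<close>

lemma L2_sqnorm_tendsto_0:
  assumes "((\<lambda>i. L2_sqnorm \<Omega> (u i)) \<longlongrightarrow> 0) F" "\<forall>\<^sub>F i in F. sq_int (lebesgue_on \<Omega>) (u i)"
  shows "((\<lambda>i. l2 (lebesgue_on \<Omega>) (u i)) \<longlongrightarrow> 0) F"
proof -
  have "((\<lambda>i. ennreal ((l2 (lebesgue_on \<Omega>) (u i))\<^sup>2)) \<longlongrightarrow> ennreal 0) F"
    using assms(2) by (intro Lim_transform_eventually[OF assms(1)[folded ennreal_0]])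
      (auto elim!: eventually_mono simp: L2_sqnorm_eq_l2)
  then have "((\<lambda>i. (l2 (lebesgue_on \<Omega>) (u i))\<^sup>2) \<longlongrightarrow> 0) F"
    by (subst (asm) tendsto_ennreal_iff) auto
  then show ?thesis
    using tendsto_real_sqrt by fastforce
qed

text \<open>Cauchy-Schwarz bounds the tested remainder of the difference quotient by its norm, which
  tends to 0. The truncation sets can here all be the whole space.\<close>

lemma C1_time_weakly_differentiable:
  assumes "C1_time_with_derivative T (L2 \<Omega>) (L2_sqnorm \<Omega>) u u'"
  shows "\<exists>B. weakly_differentiable_curve (lebesgue_on \<Omega>) 0 T B u u'"
proof -
  let ?M = "lebesgue_on \<Omega>"
  have u: "sq_int ?M (u t)" "sq_int ?M (u' t)" if "t \<in> {0<..<T}" for t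
    using assms that by (auto simp: C1_time_with_derivative_def C0_time_def L2_iff_sq_int)
  obtain b where b: "\<And>t. t \<in> {0<..<T} \<Longrightarrow> L2_sqnorm \<Omega> (u' t) \<le> ennreal b"
    using assms unfolding C1_time_with_derivative_def C0_time_def by blast
  have lim: "((\<lambda>s. l2 ?M (\<lambda>x. (u s x - u t x) /\<^sub>R (s - t) - u' t x)) \<longlongrightarrow> 0) (at t)"
    if t: "t \<in> {0<..<T}" for t
  proof (rule L2_sqnorm_tendsto_0)
    show "((\<lambda>s. L2_sqnorm \<Omega> (\<lambda>x. (u s x - u t x) /\<^sub>R (s - t) - u' t x)) \<longlongrightarrow> 0) (at t)"
      using assms t by (auto simp: C1_time_with_derivative_def has_time_derivative_def)
    have "\<forall>\<^sub>F s in at t. s \<in> {0<..<T}"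
      using t by (intro eventually_at_in_open') auto
    then show "\<forall>\<^sub>F s in at t. sq_int ?M (\<lambda>x. (u s x - u t x) /\<^sub>R (s - t) - u' t x)"
      by eventually_elim (intro sq_int_diff sq_int_scaleR u t)
  qed
  \<comment> \<open>A negative \<open>b\<close> is possible and stands for the bound 0, since
    \<open>ennreal\<close> truncates it.\<close>
  have "weakly_differentiable_curve ?M 0 T (sqrt (max 0 b)) u u'"
  proof
    fix t assume t: "t \<in> {0<..<T}"
    show "sq_int ?M (u t)" "sq_int ?M (u' t)"
      using u t by auto
    have "ennreal ((l2 ?M (u' t))\<^sup>2) \<le> ennreal (max 0 b)"
      using b[OF t] L2_sqnorm_eq_l2[OF u(2)[OF t]] by (simp add: ennreal_max_0)
    then show "l2 ?M (u' t) \<le> sqrt (max 0 b)"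
      by (intro real_le_rsqrt) (simp add: ennreal_le_iff)
  next
    fix \<psi> :: field
    assume \<psi>: "sq_int ?M \<psi>"
    have "((\<lambda>s. LINT x|?M. u s x \<bullet> \<psi> x) has_real_derivative (LINT x|?M. u' t x \<bullet> \<psi> x)) (at t)"
      if t: "t \<in> {0<..<T}" for t
      unfolding has_field_derivative_iff
    proof (rule LIM_zero_cancel, rule Lim_null_comparison)
      let ?r = "\<lambda>s x. (u s x - u t x) /\<^sub>R (s - t) - u' t x"
      have "\<forall>\<^sub>F s in at t. s \<in> {0<..<T}"
        using t by (intro eventually_at_in_open') auto
      then show "\<forall>\<^sub>F s in at t. norm (((LINT x|?M. u s x \<bullet> \<psi> x) - (LINT x|?M. u t x \<bullet> \<psi> x)) / (s - t)
          - (LINT x|?M. u' t x \<bullet> \<psi> x)) \<le> l2 ?M (?r s) * l2 ?M \<psi>"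
      proof eventually_elim
        case (elim s)
        have eq: "(LINT x|?M. ?r s x \<bullet> \<psi> x) = ((LINT x|?M. u s x \<bullet> \<psi> x) - (LINT x|?M. u t x \<bullet> \<psi> x)) / (s - t)
          - (LINT x|?M. u' t x \<bullet> \<psi> x)"
          using sq_int_integrable_inner[OF u(1)[OF elim] \<psi>] sq_int_integrable_inner[OF u(1)[OF t] \<psi>]
            sq_int_integrable_inner[OF u(2)[OF t] \<psi>]
          by (simp add: inner_diff_left divide_inverse mult.commute)
        have r: "sq_int ?M (?r s)"
          by (intro sq_int_diff sq_int_scaleR u t elim)
        show ?case
          unfolding real_norm_def eq[symmetric] using r \<psi> by (rule l2_Cauchy_Schwarz)
      qed
      show "((\<lambda>s. l2 ?M (?r s) * l2 ?M \<psi>) \<longlongrightarrow> 0) (at t)"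
        using lim[OF t] by (rule tendsto_mult_left_zero)
    qed
    moreover have "(LINT x|?M. v x \<bullet> (indicat_real (space ?M) x *\<^sub>R \<psi> x)) = (LINT x|?M. v x \<bullet> \<psi> x)" for v
      by (rule Bochner_Integration.integral_cong) auto
    ultimately show "\<exists>A. (\<forall>n. A n \<in> sets ?M) \<and> (AE x in ?M. \<forall>\<^sub>F n in sequentially. x \<in> A n) \<and>
        (\<forall>n::nat. \<forall>t\<in>{0<..<T}.
          ((\<lambda>s. LINT x|?M. u s x \<bullet> (indicat_real (A n) x *\<^sub>R \<psi> x)) has_real_derivative
            (LINT x|?M. u' t x \<bullet> (indicat_real (A n) x *\<^sub>R \<psi> x))) (at t))"
      by (intro exI[of _ "\<lambda>_. space ?M"]) auto
  qed
  then show ?thesis by blast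
qed

section \<open>The energy field and its weak derivative\<close>

text \<open>Chosen such that \<open>energy\<close> is half its square integral for suitable weights.\<close>

definition energy_field ::
  "('a \<Rightarrow> real) \<Rightarrow> ('a \<Rightarrow> real) \<Rightarrow> real \<Rightarrow> ('a \<Rightarrow> 'b::euclidean_space) \<Rightarrow> ('a \<Rightarrow> 'b) \<Rightarrow> 'a \<Rightarrow> 'b \<times> real \<times> 'b" where
  "energy_field \<alpha> \<beta> \<gamma> e h x = (\<alpha> x *\<^sub>R e x, \<beta> x * (norm (e x))\<^sup>2, \<gamma> *\<^sub>R h x)"

definition energy_field_derivative ::
  "('a \<Rightarrow> real) \<Rightarrow> ('a \<Rightarrow> real) \<Rightarrow> real \<Rightarrow> ('a \<Rightarrow> 'b::euclidean_space) \<Rightarrow> ('a \<Rightarrow> 'b) \<Rightarrow> ('a \<Rightarrow> 'b)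
    \<Rightarrow> 'a \<Rightarrow> 'b \<times> real \<times> 'b" where
  "energy_field_derivative \<alpha> \<beta> \<gamma> e e' h' x =
    (\<alpha> x *\<^sub>R e' x, 2 * \<beta> x * (e x \<bullet> e' x), \<gamma> *\<^sub>R h' x)"

text \<open>The outer entries are linear in \<open>E\<close> and \<open>H\<close>. The middle one,
  tested with a truncated function, is an integral of |E|^2 with a bounded weight, whose derivative
  is known.\<close>

lemma energy_field_weakly_differentiable:
  fixes E E' H H' :: "real \<Rightarrow> 'a \<Rightarrow> 'b::euclidean_space"
  assumes E: "weakly_differentiable_curve M a b BE E E'"
    and H: "weakly_differentiable_curve M a b BH H H'"
    and [measurable]: "\<alpha> \<in> borel_measurable M" "\<beta> \<in> borel_measurable M"
    and Z: "\<And>t. t \<in> {a<..<b} \<Longrightarrow> sq_int M (energy_field \<alpha> \<beta> \<gamma> (E t) (H t))"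
    and Z': "\<And>t. t \<in> {a<..<b} \<Longrightarrow> sq_int M (energy_field_derivative \<alpha> \<beta> \<gamma> (E t) (E' t) (H' t))"
    and B: "\<And>t. t \<in> {a<..<b} \<Longrightarrow> l2 M (energy_field_derivative \<alpha> \<beta> \<gamma> (E t) (E' t) (H' t)) \<le> B"
  shows "weakly_differentiable_curve M a b B (\<lambda>t. energy_field \<alpha> \<beta> \<gamma> (E t) (H t))
    (\<lambda>t. energy_field_derivative \<alpha> \<beta> \<gamma> (E t) (E' t) (H' t))"
proof
  interpret E: weakly_differentiable_curve M a b BE E E' by fact
  interpret H: weakly_differentiable_curve M a b BH H H' by fact
  fix \<psi> :: "'a \<Rightarrow> 'b \<times> real \<times> 'b"
  assume \<psi>: "sq_int M \<psi>"
  define \<psi>1 \<psi>2 \<psi>3 where "\<psi>1 x = fst (\<psi> x)" and "\<psi>2 x = fst (snd (\<psi> x))"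
    and "\<psi>3 x = snd (snd (\<psi> x))" for x
  have \<psi>_split: "\<psi> x = (\<psi>1 x, \<psi>2 x, \<psi>3 x)" for x
    by (simp add: \<psi>1_def \<psi>2_def \<psi>3_def)
  have \<psi>i: "sq_int M \<psi>1" "sq_int M \<psi>2" "sq_int M \<psi>3"
    unfolding \<psi>1_def[abs_def] \<psi>2_def[abs_def] \<psi>3_def[abs_def]
    by (intro sq_int_fst sq_int_snd \<psi>)+
  then have [measurable]: "\<psi>1 \<in> borel_measurable M" "\<psi>2 \<in> borel_measurable M" "\<psi>3 \<in> borel_measurable M"
    by (auto simp: sq_int_def)
  \<comment> \<open>Bounding \<open>\<alpha>\<close> keeps its product with \<open>\<psi>1\<close>
    square integrable. The product of \<open>\<beta>\<close> and \<open>\<psi>2\<close> multiplies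
    |E|^2, which is merely integrable, and so must itself be bounded; hence \<open>\<psi>2\<close>
    is cut off as well.\<close>
  define A :: "nat \<Rightarrow> 'a set" where
    "A n = {x \<in> space M. \<bar>\<alpha> x\<bar> \<le> real n \<and> \<bar>\<beta> x\<bar> \<le> real n \<and> \<bar>\<psi>2 x\<bar> \<le> real n}" for n
  have A [measurable]: "A n \<in> sets M" for n
    unfolding A_def by measurable
  have A_lim: "\<forall>\<^sub>F n in sequentially. x \<in> A n" if "x \<in> space M" for x
    using eventually_ge_at_top[of "nat \<lceil>\<bar>\<alpha> x\<bar>\<rceil>"] eventually_ge_at_top[of "nat \<lceil>\<bar>\<beta> x\<bar>\<rceil>"]
      eventually_ge_at_top[of "nat \<lceil>\<bar>\<psi>2 x\<bar>\<rceil>"]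
    by eventually_elim (use that in \<open>auto simp: A_def nat_le_iff ceiling_le_iff\<close>)
  have "((\<lambda>s. LINT x|M. energy_field \<alpha> \<beta> \<gamma> (E s) (H s) x \<bullet> (indicat_real (A n) x *\<^sub>R \<psi> x))
      has_real_derivative (LINT x|M. energy_field_derivative \<alpha> \<beta> \<gamma> (E t) (E' t) (H' t) x \<bullet>
        (indicat_real (A n) x *\<^sub>R \<psi> x))) (at t)" if t: "t \<in> {a<..<b}" for n t
  proof -
    \<comment> \<open>Weights and cut-off are shifted onto the test functions, which leaves
      \<open>E\<close>, |E|^2 and \<open>H\<close> bare.\<close>
    define \<psi>a \<phi> \<psi>c where "\<psi>a x = (indicat_real (A n) x * \<alpha> x) *\<^sub>R \<psi>1 x"
      and "\<phi> x = indicat_real (A n) x * \<beta> x * \<psi>2 x"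
      and "\<psi>c x = (indicat_real (A n) x * \<gamma>) *\<^sub>R \<psi>3 x" for x
    have \<psi>a: "sq_int M \<psi>a"
      by (rule sq_int_bound[OF \<psi>i(1), where C="real n"])
        (auto simp: \<psi>a_def[abs_def] A_def indicator_def intro!: mult_right_mono AE_I2)
    have \<psi>c: "sq_int M \<psi>c"
      by (rule sq_int_bound[OF \<psi>i(3), where C="\<bar>\<gamma>\<bar>"])
        (auto simp: \<psi>c_def[abs_def] indicator_def intro!: AE_I2)
    have \<phi>_meas [measurable]: "\<phi> \<in> borel_measurable M"
      unfolding \<phi>_def[abs_def] by measurable
    have \<phi>_le: "\<bar>\<phi> x\<bar> \<le> real n * real n" for x
      by (auto simp: \<phi>_def A_def indicator_def abs_mult intro!: mult_mono)
    have \<phi>u: "sq_int M (\<lambda>x. \<phi> x *\<^sub>R u x)" if "sq_int M u" for u :: "'a \<Rightarrow> 'b"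
      by (rule sq_int_bound[OF that, where C="real n * real n"])
        (use that \<phi>_le in \<open>auto simp: sq_int_def intro!: AE_I2 mult_right_mono\<close>)
    have near: "\<forall>\<^sub>F s in nhds t. s \<in> {a<..<b}"
      using t by (intro eventually_nhds_in_open) auto
    have "((\<lambda>s. (LINT x|M. E s x \<bullet> \<psi>a x) + (LINT x|M. \<phi> x * (norm (E s x))\<^sup>2) + (LINT x|M. H s x \<bullet> \<psi>c x))
        has_real_derivative (LINT x|M. E' t x \<bullet> \<psi>a x) + 2 * (LINT x|M. \<phi> x * (E t x \<bullet> E' t x))
          + (LINT x|M. H' t x \<bullet> \<psi>c x)) (at t)"
      by (intro DERIV_add E.has_real_derivative_inner H.has_real_derivative_inner
          E.has_real_derivative_weighted_norm[OF t \<phi>_meas \<phi>_le] t \<psi>a \<psi>c)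
    moreover have "(LINT x|M. E' t x \<bullet> \<psi>a x) + 2 * (LINT x|M. \<phi> x * (E t x \<bullet> E' t x))
          + (LINT x|M. H' t x \<bullet> \<psi>c x) =
        (LINT x|M. energy_field_derivative \<alpha> \<beta> \<gamma> (E t) (E' t) (H' t) x \<bullet> (indicat_real (A n) x *\<^sub>R \<psi> x))"
    proof -
      have "(LINT x|M. E' t x \<bullet> \<psi>a x) + 2 * (LINT x|M. \<phi> x * (E t x \<bullet> E' t x))
          + (LINT x|M. H' t x \<bullet> \<psi>c x) =
        (LINT x|M. E' t x \<bullet> \<psi>a x + 2 * (\<phi> x * (E t x \<bullet> E' t x)) + H' t x \<bullet> \<psi>c x)"
        using sq_int_integrable_inner[OF E.sq_int_Z'[OF t] \<psi>a]
          sq_int_integrable_inner[OF H.sq_int_Z'[OF t] \<psi>c]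
          sq_int_integrable_inner[OF \<phi>u[OF E.sq_int_Z[OF t]] E.sq_int_Z'[OF t]]
        by simp
      also have "\<dots> = (LINT x|M. energy_field_derivative \<alpha> \<beta> \<gamma> (E t) (E' t) (H' t) x \<bullet>
          (indicat_real (A n) x *\<^sub>R \<psi> x))"
        by (rule Bochner_Integration.integral_cong)
          (simp_all add: energy_field_derivative_def \<psi>_split \<psi>a_def \<phi>_def \<psi>c_def algebra_simps)
      finally show ?thesis .
    qed
    moreover have "\<forall>\<^sub>F s in nhds t.
        (LINT x|M. E s x \<bullet> \<psi>a x) + (LINT x|M. \<phi> x * (norm (E s x))\<^sup>2) + (LINT x|M. H s x \<bullet> \<psi>c x)
        = (LINT x|M. energy_field \<alpha> \<beta> \<gamma> (E s) (H s) x \<bullet> (indicat_real (A n) x *\<^sub>R \<psi> x))"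
      using near
    proof eventually_elim
      case (elim s)
      have "integrable M (\<lambda>x. \<phi> x * (norm (E s x))\<^sup>2)"
        using sq_int_integrable_inner[OF \<phi>u[OF E.sq_int_Z[OF elim]] E.sq_int_Z[OF elim]]
        by (simp add: dot_square_norm)
      then have "(LINT x|M. E s x \<bullet> \<psi>a x) + (LINT x|M. \<phi> x * (norm (E s x))\<^sup>2) + (LINT x|M. H s x \<bullet> \<psi>c x)
        = (LINT x|M. E s x \<bullet> \<psi>a x + \<phi> x * (norm (E s x))\<^sup>2 + H s x \<bullet> \<psi>c x)"
        using sq_int_integrable_inner[OF E.sq_int_Z[OF elim] \<psi>a]
          sq_int_integrable_inner[OF H.sq_int_Z[OF elim] \<psi>c]
        by simp
      also have "\<dots> = (LINT x|M. energy_field \<alpha> \<beta> \<gamma> (E s) (H s) x \<bullet> (indicat_real (A n) x *\<^sub>R \<psi> x))"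
        by (rule Bochner_Integration.integral_cong)
          (simp_all add: energy_field_def \<psi>_split \<psi>a_def \<phi>_def \<psi>c_def algebra_simps)
      finally show ?case .
    qed
    ultimately show ?thesis
      by (simp add: DERIV_cong_ev)
  qed
  then show "\<exists>A. (\<forall>n. A n \<in> sets M) \<and> (AE x in M. \<forall>\<^sub>F n in sequentially. x \<in> A n) \<and>
      (\<forall>n::nat. \<forall>t\<in>{a<..<b}.
        ((\<lambda>s. LINT x|M. energy_field \<alpha> \<beta> \<gamma> (E s) (H s) x \<bullet> (indicat_real (A n) x *\<^sub>R \<psi> x))
          has_real_derivative (LINT x|M. energy_field_derivative \<alpha> \<beta> \<gamma> (E t) (E' t) (H' t) x \<bullet>
            (indicat_real (A n) x *\<^sub>R \<psi> x))) (at t))"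
    using A A_lim by (intro exI[of _ A]) (auto intro!: AE_I2)
qed (use Z Z' B in auto)

section \<open>Measurability in time of the norms of the currents\<close>

text \<open>Needed to split the time integral of a sum of two norms. A simple function has finitely
  many values, so its norm is simple in time, and these norms converge almost everywhere to that of
  \<open>u\<close>.\<close>

lemma strongly_measurable_sqnorm:
  assumes w: "w \<in> borel_measurable (lebesgue_on \<Omega>)" "AE x in lebesgue_on \<Omega>. 0 \<le> w x"
    and u: "u \<in> L2_time T (L2w \<Omega> w) (sqnorm \<Omega> w)"
  shows "\<exists>g \<in> borel_measurable (lebesgue_on {0<..<T}).
    AE t in lebesgue_on {0<..<T}. sqnorm \<Omega> w (u t) = g t"
proof -
  let ?M = "lebesgue_on \<Omega>"
  obtain s where s: "\<And>n. simple_function (lebesgue_on {0<..<T}) (s n)"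
      "\<And>n t. t \<in> {0<..<T} \<Longrightarrow> s n t \<in> L2w \<Omega> w"
      "AE t in lebesgue_on {0<..<T}. (\<lambda>n. sqnorm \<Omega> w (\<lambda>x. s n t x - u t x)) \<longlonglongrightarrow> 0"
    using u unfolding L2_time_def strongly_measurable_def by blast
  have sq: "sq_int ?M (\<lambda>x. sqrt (w x) *\<^sub>R v x)" if "v \<in> L2w \<Omega> w" for v :: field
    using that sqnorm_finite_iff[OF w, of v] by (simp add: L2w_def)
  have [measurable]: "(\<lambda>t. sqnorm \<Omega> w (s n t)) \<in> borel_measurable (lebesgue_on {0<..<T})" for n
    by (rule borel_measurable_simple_function[OF simple_function_compose1[OF s(1)]])
  show ?thesis
  proof (rule bexI)
    \<comment> \<open>The limsup is measurable without any convergence, and it is the limit wherever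
      one exists.\<close>
    show "(\<lambda>t. limsup (\<lambda>n. sqnorm \<Omega> w (s n t))) \<in> borel_measurable (lebesgue_on {0<..<T})"
      by measurable
    show "AE t in lebesgue_on {0<..<T}. sqnorm \<Omega> w (u t) = limsup (\<lambda>n. sqnorm \<Omega> w (s n t))"
      using s(3) AE_space
    proof eventually_elim
      case (elim t)
      then have t: "t \<in> {0<..<T}" by simp
      have ut: "sq_int ?M (\<lambda>x. sqrt (w x) *\<^sub>R u t x)"
        using u t by (intro sq) (simp add: L2_time_def)
      have st: "sq_int ?M (\<lambda>x. sqrt (w x) *\<^sub>R s n t x)" for n
        using s(2)[OF t] by (rule sq)
      have d: "sq_int ?M (\<lambda>x. sqrt (w x) *\<^sub>R (s n t x - u t x))" for n
        using sq_int_diff[OF st ut] by (simp add: scaleR_diff_right)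
      have "(\<lambda>n. ennreal ((l2 ?M (\<lambda>x. sqrt (w x) *\<^sub>R (s n t x - u t x)))\<^sup>2)) \<longlonglongrightarrow> ennreal 0"
        using elim(1) sqnorm_eq_l2[OF w(2) d] by simp
      then have "(\<lambda>n. (l2 ?M (\<lambda>x. sqrt (w x) *\<^sub>R (s n t x - u t x)))\<^sup>2) \<longlonglongrightarrow> 0"
        by (subst (asm) tendsto_ennreal_iff) auto
      then have "(\<lambda>n. l2 ?M (\<lambda>x. sqrt (w x) *\<^sub>R s n t x - sqrt (w x) *\<^sub>R u t x)) \<longlonglongrightarrow> 0"
        using tendsto_real_sqrt by (fastforce simp: scaleR_diff_right)
      then have "(\<lambda>n. (l2 ?M (\<lambda>x. sqrt (w x) *\<^sub>R s n t x))\<^sup>2) \<longlonglongrightarrow> (l2 ?M (\<lambda>x. sqrt (w x) *\<^sub>R u t x))\<^sup>2"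
        using st ut by (intro l2_power2_tendsto) auto
      then have "(\<lambda>n. sqnorm \<Omega> w (s n t)) \<longlonglongrightarrow> sqnorm \<Omega> w (u t)"
        using sqnorm_eq_l2[OF w(2) st] sqnorm_eq_l2[OF w(2) ut] by (simp add: tendsto_ennrealI)
      then show ?case
        using lim_imp_Limsup[OF sequentially_bot] by metis
    qed
  qed
qed

section \<open>The energy as a squared norm\<close>

text \<open>\<open>e\<close> is an eigenvector of the permittivity it generates. The resulting 3
  explains the 3/2 in the energy: the derivative of (3/4) |e|^4 in direction v is 3 |e|^2 (e .
  v).\<close>

lemma permittivity_mult_vec_inner:
  "(permittivity eps0 c1 c3 e *v v) \<bullet> e = eps0 * (1 + c1 + 3 * c3 * (norm e)\<^sup>2) * (e \<bullet> v)"
  by (simp add: permittivity_mult_vec inner_add_left dot_square_norm inner_commute[of v e] algebra_simps)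

lemma ennreal_energy_sum:
  assumes "0 \<le> p" "0 \<le> q" "0 \<le> r"
  shows "1/2 * (ennreal p + 3/2 * ennreal q + ennreal r) = ennreal (1/2 * (p + (3/2 * q + r)))"
proof -
  have "1/2 = ennreal (1/2)" "3/2 = ennreal (3/2)"
    using divide_ennreal[OF zero_le_one zero_less_numeral, of "num.Bit0 num.One"]
      divide_ennreal[OF zero_le_numeral zero_less_numeral, of "num.Bit1 num.One" "num.Bit0 num.One"]
    by (simp_all only: ennreal_numeral ennreal_1)
  moreover have "ennreal (1/2 * (p + (3/2 * q + r))) = ennreal (1/2) * ennreal (p + (3/2 * q + r))"
    using assms by (intro ennreal_mult) simp_all
  moreover have "ennreal (p + (3/2 * q + r)) = ennreal p + (ennreal (3/2 * q) + ennreal r)"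
    using assms by (simp add: ennreal_plus)
  moreover have "ennreal (3/2 * q) = ennreal (3/2) * ennreal q"
    using assms by (intro ennreal_mult) simp_all
  ultimately show ?thesis
    by (simp only: add.assoc)
qed

text \<open>The 3/2 of the quartic term is stored as its root in \<open>\<beta>\<close>. Square
  integrability of the whole energy field passes to its entries and makes all three terms
  finite.\<close>

lemma energy_eq_l2:
  fixes \<Omega> :: "(real^3) set" and eps0 mu0 :: real and chi1 chi3 :: "real^3 \<Rightarrow> real"
    and e h :: field
  defines "\<alpha> \<equiv> \<lambda>x. sqrt (eps0 * (1 + chi1 x))"
    and "\<beta> \<equiv> \<lambda>x. sqrt (3/2) * sqrt (eps0 * chi3 x)"
    and "\<gamma> \<equiv> sqrt mu0"
  assumes eps0: "0 < eps0" and mu0: "0 < mu0"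
    and chi1: "AE x in lebesgue_on \<Omega>. 0 \<le> chi1 x" and chi3: "AE x in lebesgue_on \<Omega>. 0 \<le> chi3 x"
    and Z: "sq_int (lebesgue_on \<Omega>) (energy_field \<alpha> \<beta> \<gamma> e h)"
  shows "energy \<Omega> eps0 mu0 chi1 chi3 e h =
    ennreal (1/2 * (l2 (lebesgue_on \<Omega>) (energy_field \<alpha> \<beta> \<gamma> e h))\<^sup>2)"
proof -
  let ?M = "lebesgue_on \<Omega>"
  have 1: "sq_int ?M (\<lambda>x. \<alpha> x *\<^sub>R e x)" and 2: "sq_int ?M (\<lambda>x. \<beta> x * (norm (e x))\<^sup>2)"
    and 3: "sq_int ?M (\<lambda>x. \<gamma> *\<^sub>R h x)"
    using sq_int_fst[OF Z] sq_int_fst[OF sq_int_snd[OF Z]] sq_int_snd[OF sq_int_snd[OF Z]]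
    by (simp_all add: energy_field_def)
  have \<beta>_eq: "(\<lambda>x. \<beta> x * (norm (e x))\<^sup>2) = (\<lambda>x. sqrt (3/2) *\<^sub>R (sqrt (eps0 * chi3 x) *\<^sub>R (norm (e x))\<^sup>2))"
    by (simp add: \<beta>_def fun_eq_iff)
  have 4: "sq_int ?M (\<lambda>x. sqrt (eps0 * chi3 x) *\<^sub>R (norm (e x))\<^sup>2)"
    using sq_int_scaleR[OF 2, of "1 / sqrt (3/2)"] by (simp add: \<beta>_def)
  have "(l2 ?M (energy_field \<alpha> \<beta> \<gamma> e h))\<^sup>2 = (l2 ?M (\<lambda>x. \<alpha> x *\<^sub>R e x))\<^sup>2
      + (3/2 * (l2 ?M (\<lambda>x. sqrt (eps0 * chi3 x) *\<^sub>R (norm (e x))\<^sup>2))\<^sup>2 + (l2 ?M (\<lambda>x. \<gamma> *\<^sub>R h x))\<^sup>2)"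
    unfolding energy_field_def[abs_def] sq_int_Pair(2)[OF 1 sq_int_Pair(1)[OF 2 3]]
      sq_int_Pair(2)[OF 2 3] unfolding \<beta>_eq l2_scaleR by (simp add: power_mult_distrib)
  moreover have "sqnorm \<Omega> (\<lambda>x. eps0 * (1 + chi1 x)) e = ennreal ((l2 ?M (\<lambda>x. \<alpha> x *\<^sub>R e x))\<^sup>2)"
    using 1 chi1 eps0 unfolding \<alpha>_def
    by (intro sqnorm_eq_l2) (auto elim!: eventually_mono)
  moreover have "sqnorm \<Omega> (\<lambda>x. eps0 * chi3 x) (\<lambda>x. (norm (e x))\<^sup>2) =
      ennreal ((l2 ?M (\<lambda>x. sqrt (eps0 * chi3 x) *\<^sub>R (norm (e x))\<^sup>2))\<^sup>2)"
    using 4 chi3 eps0 by (intro sqnorm_eq_l2) (auto elim!: eventually_mono)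
  moreover have "sqnorm \<Omega> (\<lambda>_. mu0) h = ennreal ((l2 ?M (\<lambda>x. \<gamma> *\<^sub>R h x))\<^sup>2)"
    using 3 mu0 unfolding \<gamma>_def by (intro sqnorm_eq_l2) auto
  ultimately show ?thesis
    unfolding energy_def by (simp only: ennreal_energy_sum zero_le_power2)
qed

section \<open>The energy estimate\<close>

theorem corollary3p2:
  fixes \<Omega> :: "(real^3) set"
    and T eps0 mu0 :: real
    and chi1 chi3 :: "real^3 \<Rightarrow> real"
    and Je Jm E H :: "real \<Rightarrow> field"
    and E0 H0 :: field
  defines "we \<equiv> (\<lambda>x. 1 / (eps0 * (1 + chi1 x)))"
    and "wm \<equiv> (\<lambda>x. 1 / mu0)"
  assumes "simply_connected_domain \<Omega>" and "Ck_boundary 1 \<Omega>"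
    and "0 < T" and "0 < eps0" and "0 < mu0"
    and "chi1 \<in> borel_measurable (lebesgue_on \<Omega>)" and "AE x in lebesgue_on \<Omega>. 0 \<le> chi1 x"
    and "chi3 \<in> borel_measurable (lebesgue_on \<Omega>)" and "AE x in lebesgue_on \<Omega>. 0 \<le> chi3 x"
    and "has_weak_div \<Omega> (\<lambda>x. mu0 *\<^sub>R H0 x) (\<lambda>x. 0)"
    and "\<forall>\<phi>\<in>test_functions UNIV. normal_trace \<Omega> H0 \<phi> = 0"
    and "Je \<in> L2_time T (L2w \<Omega> we) (sqnorm \<Omega> we)"
    and "Jm \<in> L2_time T (L2w \<Omega> wm) (sqnorm \<Omega> wm)"
    and "weak_solution \<Omega> T eps0 mu0 chi1 chi3 Je Jm E0 H0 E H"
  shows "\<forall>t\<in>{0<..<T}.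
    energy \<Omega> eps0 mu0 chi1 chi3 (E t) (H t)
      \<le> 2 * energy \<Omega> eps0 mu0 chi1 chi3 E0 H0
        + ennreal t * (L2_time_sqnorm T (sqnorm \<Omega> we) Je + L2_time_sqnorm T (sqnorm \<Omega> wm) Jm)"
proof
  fix t0 assume t0: "t0 \<in> {0<..<T}"
  let ?M = "lebesgue_on \<Omega>"
  note T = \<open>0 < T\<close> and eps0 = \<open>0 < eps0\<close> and mu0 = \<open>0 < mu0\<close>
  note [measurable] = \<open>chi1 \<in> borel_measurable ?M\<close> \<open>chi3 \<in> borel_measurable ?M\<close>
  have chi: "AE x in ?M. 0 \<le> chi1 x \<and> 0 \<le> chi3 x"
    using \<open>AE x in ?M. 0 \<le> chi1 x\<close> \<open>AE x in ?M. 0 \<le> chi3 x\<close> by eventually_elim auto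
  note weak = \<open>weak_solution \<Omega> T eps0 mu0 chi1 chi3 Je Jm E0 H0 E H\<close>[unfolded weak_solution_def Let_def]
  obtain E' H' where
    C1E: "C1_time_permittivity \<Omega> T eps0 chi1 chi3 E E E'" and
    C1H: "C1_time_with_derivative T (L2 \<Omega>) (L2_sqnorm \<Omega>) H H'" and
    eqE: "\<And>t \<Psi>. t \<in> {0<..<T} \<Longrightarrow> \<Psi> \<in> L2 \<Omega> \<Longrightarrow>
      pairing_exists \<Omega> (\<lambda>x. permittivity eps0 (chi1 x) (chi3 x) (E t x) *v E' t x) \<Psi> \<and>
      pairing_exists \<Omega> (Je t) \<Psi> \<and>
      pairing \<Omega> (\<lambda>x. permittivity eps0 (chi1 x) (chi3 x) (E t x) *v E' t x) \<Psi>
        - pairing \<Omega> (curl \<Omega> (H t)) \<Psi> = - pairing \<Omega> (Je t) \<Psi>" and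
    eqH: "\<And>t \<Phi>. t \<in> {0<..<T} \<Longrightarrow> \<Phi> \<in> Hcurl \<Omega> \<Longrightarrow>
      pairing \<Omega> (\<lambda>x. mu0 *\<^sub>R H' t x) \<Phi> + pairing \<Omega> (E t) (curl \<Omega> \<Phi>) = - pairing \<Omega> (Jm t) \<Phi>"
    using weak by blast
  have Hcurl: "H t \<in> Hcurl \<Omega>" if "t \<in> {0<..<T}" for t
    using weak that unfolding C0_time_def by blast
  have initE: "initial_value \<Omega> E E0" and initH: "initial_value \<Omega> H H0"
    using weak by auto
  obtain BE where E: "weakly_differentiable_curve ?M 0 T BE E E'"
    using C1E C1_time_weakly_differentiable unfolding C1_time_permittivity_def by blast
  obtain BH where H: "weakly_differentiable_curve ?M 0 T BH H H'"
    using C1H C1_time_weakly_differentiable by blast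
  interpret E: weakly_differentiable_curve ?M 0 T BE E E' by (rule E)
  interpret H: weakly_differentiable_curve ?M 0 T BH H H' by (rule H)

  \<comment> \<open>Bounds for the energy field and its formal derivative\<close>
  define \<alpha> \<beta> \<gamma> where "\<alpha> x = sqrt (eps0 * (1 + chi1 x))"
    and "\<beta> x = sqrt (3/2) * sqrt (eps0 * chi3 x)" and "\<gamma> = sqrt mu0" for x
  have [measurable]: "\<alpha> \<in> borel_measurable ?M" "\<beta> \<in> borel_measurable ?M"
    unfolding \<alpha>_def[abs_def] \<beta>_def[abs_def] by measurable
  have ab: "AE x in ?M. (\<alpha> x)\<^sup>2 = eps0 * (1 + chi1 x) \<and> (\<beta> x)\<^sup>2 = 3/2 * (eps0 * chi3 x) \<and> 0 < \<alpha> x \<and> 0 \<le> \<beta> x"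
    using chi by eventually_elim
      (use eps0 in \<open>auto simp: \<alpha>_def \<beta>_def power_mult_distrib intro!: mult_pos_pos\<close>)
  have g2: "\<gamma>\<^sup>2 = mu0" "0 < \<gamma>"
    using mu0 by (auto simp: \<gamma>_def)
  define Z where "Z e h = energy_field \<alpha> \<beta> \<gamma> e h" for e h :: field
  define Z' where "Z' t = energy_field_derivative \<alpha> \<beta> \<gamma> (E t) (E' t) (H' t)" for t

  \<comment> \<open>The root of the permittivity applied to \<open>v\<close>, which is what the
    solution space controls: \<open>P E\<close> will dominate the electric entries of the energy
    field and \<open>P E'\<close> those of its derivative.\<close>
  define P where "P v t x = psd_sqrt (permittivity eps0 (chi1 x) (chi3 x) (E t x)) *v v t x"
    for v :: "real \<Rightarrow> field" and t x
  \<comment> \<open>The 2/3 cancels the 3/2 built into \<open>\<beta>\<close> and leaves the weight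
    \<open>eps0 * chi3\<close>.\<close>
  have P_norm: "AE x in ?M. (norm (P v t x))\<^sup>2 = (\<alpha> x)\<^sup>2 * (norm (v t x))\<^sup>2
      + 2/3 * (\<beta> x)\<^sup>2 * ((norm (E t x))\<^sup>2 * (norm (v t x))\<^sup>2 + 2 * (E t x \<bullet> v t x)\<^sup>2)" for v t
    using chi ab
    by eventually_elim (use eps0 in \<open>simp add: P_def norm_psd_sqrt_permittivity algebra_simps\<close>)
  have P_C0: "P v \<in> C0_time T (L2 \<Omega>) (L2_sqnorm \<Omega>)" if "v \<in> {E, E'}" for v
    using C1E that unfolding C1_time_permittivity_def P_def[abs_def] by blast
  have P_sq: "sq_int ?M (P v t)" if "v \<in> {E, E'}" "t \<in> {0<..<T}" for v t
    using P_C0[OF that(1)] that(2) by (simp add: C0_time_def L2_iff_sq_int)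
  obtain bP where bP: "\<And>t. t \<in> {0<..<T} \<Longrightarrow> L2_sqnorm \<Omega> (P E' t) \<le> ennreal bP"
    using P_C0[of E'] unfolding C0_time_def by blast
  have P_le: "(l2 ?M (P E' t))\<^sup>2 \<le> max 0 bP" if t: "t \<in> {0<..<T}" for t
  proof -
    have "ennreal ((l2 ?M (P E' t))\<^sup>2) \<le> ennreal (max 0 bP)"
      using bP[OF t] L2_sqnorm_eq_l2[OF P_sq[of E' t]] t by (simp add: ennreal_max_0)
    then show ?thesis by (simp add: ennreal_le_iff)
  qed

  have meas [measurable]: "E t \<in> borel_measurable ?M" "E' t \<in> borel_measurable ?M"
      "H t \<in> borel_measurable ?M" "H' t \<in> borel_measurable ?M" if "t \<in> {0<..<T}" for t
    using E.sq_int_Z E.sq_int_Z' H.sq_int_Z H.sq_int_Z' that by (auto simp: sq_int_def)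

  have \<alpha>v_le: "AE x in ?M. norm (\<alpha> x *\<^sub>R v t x) \<le> 1 * norm (P v t x)" for v t
    using P_norm[of v t]
  proof eventually_elim
    case (elim x)
    then have "(norm (\<alpha> x *\<^sub>R v t x))\<^sup>2 \<le> (norm (P v t x))\<^sup>2"
      by (simp add: power_mult_distrib)
    then show ?case
      by (simp add: power2_le_iff_abs_le)
  qed
  have \<beta>v_le: "AE x in ?M. norm (2 * \<beta> x * (E t x \<bullet> v t x)) \<le> 2 * norm (P v t x)" for v t
    using P_norm[of v t]
  proof eventually_elim
    case (elim x)
    \<comment> \<open>Lowering |E|^2 |v|^2 to (E . v)^2 turns the whole cubic part of the quadratic
      form into a multiple of the square to be bounded.\<close>
    have "(E t x \<bullet> v t x)\<^sup>2 \<le> (norm (E t x))\<^sup>2 * (norm (v t x))\<^sup>2"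
      using Cauchy_Schwarz_ineq[of "E t x" "v t x"] by (simp add: dot_square_norm)
    then have "2/3 * (\<beta> x)\<^sup>2 * (3 * (E t x \<bullet> v t x)\<^sup>2) \<le>
        2/3 * (\<beta> x)\<^sup>2 * ((norm (E t x))\<^sup>2 * (norm (v t x))\<^sup>2 + 2 * (E t x \<bullet> v t x)\<^sup>2)"
      by (intro mult_left_mono) auto
    also have "\<dots> \<le> (norm (P v t x))\<^sup>2"
      unfolding elim by simp
    finally have "(2 * \<beta> x * (E t x \<bullet> v t x))\<^sup>2 \<le> 2 * (norm (P v t x))\<^sup>2"
      by (simp add: power_mult_distrib)
    also have "\<dots> \<le> (2 * norm (P v t x))\<^sup>2"
      by (simp add: power_mult_distrib)
    finally show ?case
      using power2_le_imp_le[of "\<bar>2 * \<beta> x * (E t x \<bullet> v t x)\<bar>" "2 * norm (P v t x)"] by simp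
  qed

  have Zsq: "sq_int ?M (Z (E t) (H t))" if t: "t \<in> {0<..<T}" for t
  proof -
    note [measurable] = meas[OF t]
    have "sq_int ?M (\<lambda>x. \<alpha> x *\<^sub>R E t x)"
      by (rule sq_int_bound[OF P_sq[of E t] _ \<alpha>v_le]) (use t in auto)
    \<comment> \<open>The same bound with v = \<open>E\<close>, where E . v becomes |E|^2.\<close>
    moreover have "AE x in ?M. norm (\<beta> x * (norm (E t x))\<^sup>2) \<le> 1 * norm (P E t x)"
      using \<beta>v_le[of t E] by eventually_elim (simp add: dot_square_norm abs_mult)
    then have "sq_int ?M (\<lambda>x. \<beta> x * (norm (E t x))\<^sup>2)"
      by (rule sq_int_bound[OF P_sq[of E t], rotated 3]) (use t in auto)
    ultimately show ?thesis
      unfolding Z_def energy_field_def[abs_def] by (intro sq_int_Pair sq_int_scaleR H.sq_int_Z t)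
  qed
  have Z'sq: "sq_int ?M (Z' t)"
    and Z'le: "l2 ?M (Z' t) \<le> sqrt (max 0 bP + (4 * max 0 bP + \<gamma>\<^sup>2 * BH\<^sup>2))" if t: "t \<in> {0<..<T}" for t
  proof -
    note [measurable] = meas[OF t]
    have 1: "sq_int ?M (\<lambda>x. \<alpha> x *\<^sub>R E' t x)"
      by (rule sq_int_bound[OF P_sq[of E' t] _ \<alpha>v_le]) (use t in auto)
    have 2: "sq_int ?M (\<lambda>x. 2 * \<beta> x * (E t x \<bullet> E' t x))"
      by (rule sq_int_bound[OF P_sq[of E' t] _ \<beta>v_le]) (use t in auto)
    have 3: "sq_int ?M (\<lambda>x. \<gamma> *\<^sub>R H' t x)"
      by (intro sq_int_scaleR H.sq_int_Z' t)
    show "sq_int ?M (Z' t)"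
      unfolding Z'_def energy_field_derivative_def[abs_def] by (intro sq_int_Pair 1 2 3)
    have "l2 ?M (\<lambda>x. \<alpha> x *\<^sub>R E' t x) \<le> 1 * l2 ?M (P E' t)"
      by (rule l2_le[OF P_sq[of E' t] 1 \<alpha>v_le]) (use t in auto)
    then have "(l2 ?M (\<lambda>x. \<alpha> x *\<^sub>R E' t x))\<^sup>2 \<le> (l2 ?M (P E' t))\<^sup>2"
      by (intro power_mono) auto
    moreover have "l2 ?M (\<lambda>x. 2 * \<beta> x * (E t x \<bullet> E' t x)) \<le> 2 * l2 ?M (P E' t)"
      by (rule l2_le[OF P_sq[of E' t] 2 \<beta>v_le]) (use t in auto)
    then have "(l2 ?M (\<lambda>x. 2 * \<beta> x * (E t x \<bullet> E' t x)))\<^sup>2 \<le> (2 * l2 ?M (P E' t))\<^sup>2"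
      by (intro power_mono) auto
    then have "(l2 ?M (\<lambda>x. 2 * \<beta> x * (E t x \<bullet> E' t x)))\<^sup>2 \<le> 4 * (l2 ?M (P E' t))\<^sup>2"
      by (simp add: power_mult_distrib)
    moreover have "(l2 ?M (\<lambda>x. \<gamma> *\<^sub>R H' t x))\<^sup>2 \<le> \<gamma>\<^sup>2 * BH\<^sup>2"
      using H.l2_Z'[OF t] by (auto simp: l2_scaleR power_mult_distrib intro!: mult_left_mono power_mono)
    ultimately have "(l2 ?M (Z' t))\<^sup>2 \<le> max 0 bP + (4 * max 0 bP + \<gamma>\<^sup>2 * BH\<^sup>2)"
      unfolding Z'_def energy_field_derivative_def[abs_def] sq_int_Pair(2)[OF 1 sq_int_Pair(1)[OF 2 3]]
        sq_int_Pair(2)[OF 2 3]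
      using P_le[OF t] by linarith
    then show "l2 ?M (Z' t) \<le> sqrt (max 0 bP + (4 * max 0 bP + \<gamma>\<^sup>2 * BH\<^sup>2))"
      by (rule real_le_rsqrt)
  qed
  \<comment> \<open>The summands bound the squared norms of the three entries of
    \<open>Z'\<close>.\<close>
  define B where "B = sqrt (max 0 bP + (4 * max 0 bP + \<gamma>\<^sup>2 * BH\<^sup>2))"
  have Zcurve: "weakly_differentiable_curve ?M 0 T B (\<lambda>t. Z (E t) (H t)) Z'"
    unfolding Z_def Z'_def[abs_def] B_def
    by (rule energy_field_weakly_differentiable[OF E H])
      (use Zsq Z'sq Z'le in \<open>auto simp: Z_def Z'_def\<close>)
  interpret Z: weakly_differentiable_curve ?M 0 T B "\<lambda>t. Z (E t) (H t)" Z' by (rule Zcurve)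

  \<comment> \<open>The energy field at time 0\<close>
  have E0: "sq_int ?M E0" and H0: "sq_int ?M H0"
    using initE initH by (auto simp: initial_value_def L2_iff_sq_int)
  \<comment> \<open>The quartic part of the energy is not continuous in \<open>L\<^sup>2\<close>; the initial energy is reached
    through an almost everywhere convergent subsequence and the Lipschitz bound on \<open>Z\<close>.\<close>
  define s where "s n = T / real (Suc (Suc n))" for n :: nat
  \<comment> \<open>The double successor makes the denominator at least 2, so that even the first
    time lies strictly below \<open>T\<close>.\<close>
  have s: "s n \<in> {0<..<T}" for n
    using T by (auto simp: s_def field_simps intro!: add_pos_nonneg)
  have s_lim: "filterlim s (at_right 0) sequentially"
    unfolding filterlim_at
  proof
    show "\<forall>\<^sub>F n in sequentially. s n \<in> {0<..} \<and> s n \<noteq> 0"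
      using s by (intro always_eventually allI) (metis greaterThanLessThan_iff greaterThan_iff less_irrefl)
    show "s \<longlonglongrightarrow> 0"
      unfolding s_def by (rule LIMSEQ_Suc[OF LIMSEQ_Suc[OF lim_const_over_n]])
  qed
  have init_lim: "(\<lambda>n. l2 ?M (\<lambda>x. u (s n) x - u0 x)) \<longlonglongrightarrow> 0"
    if "initial_value \<Omega> u u0" "\<And>n. sq_int ?M (u (s n))" for u u0
  proof (rule L2_sqnorm_tendsto_0)
    show "(\<lambda>n. L2_sqnorm \<Omega> (\<lambda>x. u (s n) x - u0 x)) \<longlonglongrightarrow> 0"
      using that(1) unfolding initial_value_def by (intro filterlim_compose[OF _ s_lim]) blast
    show "\<forall>\<^sub>F n in sequentially. sq_int ?M (\<lambda>x. u (s n) x - u0 x)"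
      using that by (intro always_eventually allI sq_int_diff) (auto simp: initial_value_def L2_iff_sq_int)
  qed
  have "(\<lambda>n. l2 ?M (\<lambda>x. E (s n) x - E0 x)) \<longlonglongrightarrow> 0" "(\<lambda>n. l2 ?M (\<lambda>x. H (s n) x - H0 x)) \<longlonglongrightarrow> 0"
    by (intro init_lim initE initH E.sq_int_Z H.sq_int_Z s)+
  then have lims: "(\<lambda>n. sqrt ((l2 ?M (\<lambda>x. E (s n) x - E0 x))\<^sup>2 + (l2 ?M (\<lambda>x. H (s n) x - H0 x))\<^sup>2)) \<longlonglongrightarrow> 0"
    by (auto intro!: tendsto_eq_intros)
  \<comment> \<open>Pairing the two differences yields one subsequence that serves \<open>E\<close>
    and \<open>H\<close> at once.\<close>
  define D where "D n x = (E (s n) x - E0 x, H (s n) x - H0 x)" for n x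
  have D_sq: "sq_int ?M (D n)" for n
    unfolding D_def[abs_def] by (intro sq_int_Pair sq_int_diff E.sq_int_Z H.sq_int_Z s E0 H0)
  have "l2 ?M (D n) = sqrt ((l2 ?M (\<lambda>x. E (s n) x - E0 x))\<^sup>2 + (l2 ?M (\<lambda>x. H (s n) x - H0 x))\<^sup>2)" for n
    unfolding D_def[abs_def]
    by (rule real_sqrt_unique[symmetric])
      (intro sq_int_Pair(2) sq_int_diff E.sq_int_Z H.sq_int_Z s E0 H0 l2_nonneg)+
  with lims have "(\<lambda>n. l2 ?M (D n)) \<longlonglongrightarrow> 0"
    by simp
  then obtain r where r: "strict_mono r" "AE x in ?M. (\<lambda>n. D (r n) x) \<longlonglongrightarrow> 0"
    using l2_tendsto_AE_subseq[of ?M D, OF D_sq] by blast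
  have Z_AE: "AE x in ?M. (\<lambda>n. Z (E (s (r n))) (H (s (r n))) x) \<longlonglongrightarrow> Z E0 H0 x"
    using r(2)
  proof eventually_elim
    case (elim x)
    have "(\<lambda>n. E (s (r n)) x) \<longlonglongrightarrow> E0 x" "(\<lambda>n. H (s (r n)) x) \<longlonglongrightarrow> H0 x"
      using tendsto_fst[OF elim] tendsto_snd[OF elim] by (auto simp: D_def intro: LIM_zero_cancel)
    then show ?case
      unfolding Z_def energy_field_def by (intro tendsto_intros)
  qed
  have sr_lim: "(\<lambda>n. B * \<bar>t - s (r n)\<bar>) \<longlonglongrightarrow> B * \<bar>t - 0\<bar>" for t
    using LIMSEQ_subseq_LIMSEQ[OF _ r(1), of s 0] s_lim
    by (intro tendsto_intros) (simp add: filterlim_at comp_def)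
  have [measurable]: "E0 \<in> borel_measurable ?M" "H0 \<in> borel_measurable ?M"
    using E0 H0 by (auto simp: sq_int_def)
  have Z0_meas: "Z E0 H0 \<in> borel_measurable ?M"
    unfolding Z_def energy_field_def[abs_def] by measurable
  \<comment> \<open>Here \<open>Y\<close> is the energy field at a fixed time t, and the bounds
    \<open>B * \<bar>t - s (r n)\<bar>\<close> tend to \<open>B * t\<close>.\<close>
  note Fatou = sq_int_Fatou[OF Zsq[OF s] Zsq Z0_meas Z_AE Z.l2_increment_le[OF _ s] sr_lim]
  have Z0sq: "sq_int ?M (Z E0 H0)"
    using Fatou(1)[OF t0 t0] .
  have Z0_le: "l2 ?M (\<lambda>x. Z (E t) (H t) x - Z E0 H0 x) \<le> B * t" if "t \<in> {0<..<T}" for t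
    using Fatou(2)[OF that that] that by simp

  \<comment> \<open>The currents and the energy balance\<close>
  \<comment> \<open>Dividing the currents by the roots of the weights makes them dual to the outer
    entries of \<open>Z\<close>; the quartic entry is paired with 0.\<close>
  define J where "J t x = (sqrt (we x) *\<^sub>R Je t x, 0::real, sqrt (wm x) *\<^sub>R Jm t x)" for t x
  have we: "we \<in> borel_measurable ?M" "AE x in ?M. 0 \<le> we x"
    using chi eps0 by (auto simp: we_def elim!: eventually_mono)
  have wm: "wm \<in> borel_measurable ?M" "AE x in ?M. 0 \<le> wm x"
    using mu0 by (auto simp: wm_def)
  have Je_sq: "sq_int ?M (\<lambda>x. sqrt (we x) *\<^sub>R Je t x)" if "t \<in> {0<..<T}" for t
    using assms(14) that sqnorm_finite_iff[OF we, of "Je t"] by (auto simp: L2_time_def L2w_def)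
  have Jm_sq: "sq_int ?M (\<lambda>x. sqrt (wm x) *\<^sub>R Jm t x)" if "t \<in> {0<..<T}" for t
    using assms(15) that sqnorm_finite_iff[OF wm, of "Jm t"] by (auto simp: L2_time_def L2w_def)
  have zero_sq: "sq_int ?M (\<lambda>_. 0::real)" and zero_l2: "l2 ?M (\<lambda>_. 0::real) = 0"
    by (auto simp: sq_int_def l2_def)
  have J_sq: "sq_int ?M (J t)"
    and J_l2: "ennreal ((l2 ?M (J t))\<^sup>2) = sqnorm \<Omega> we (Je t) + sqnorm \<Omega> wm (Jm t)"
    if t: "t \<in> {0<..<T}" for t
    unfolding J_def[abs_def] sqnorm_eq_l2[OF we(2) Je_sq[OF t]] sqnorm_eq_l2[OF wm(2) Jm_sq[OF t]]
    using sq_int_Pair[OF Je_sq[OF t] sq_int_Pair(1)[OF zero_sq Jm_sq[OF t]]]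
      sq_int_Pair(2)[OF zero_sq Jm_sq[OF t]] zero_l2
    by (auto simp: ennreal_plus)

  have balance: "(LINT x|?M. Z (E t) (H t) x \<bullet> Z' t x) = - (LINT x|?M. J t x \<bullet> Z (E t) (H t) x)"
    if t: "t \<in> {0<..<T}" for t
  proof -
    define D' where "D' x = permittivity eps0 (chi1 x) (chi3 x) (E t x) *v E' t x" for x
    have EL2: "E t \<in> L2 \<Omega>"
      using E.sq_int_Z[OF t] by (simp add: L2_iff_sq_int)
    have Jm_sq': "sq_int ?M (Jm t)"
      using sq_int_scaleR[OF Jm_sq[OF t], of \<gamma>] mu0 by (simp add: wm_def \<gamma>_def real_sqrt_divide)
    \<comment> \<open>The two electric integrals exist as part of the weak equation, since the
      susceptibilities may be unbounded. The two magnetic ones are products of square integrable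
      fields.\<close>
    have int: "integrable ?M (\<lambda>x. D' x \<bullet> E t x)" "integrable ?M (\<lambda>x. Je t x \<bullet> E t x)"
        "integrable ?M (\<lambda>x. (mu0 *\<^sub>R H' t x) \<bullet> H t x)" "integrable ?M (\<lambda>x. Jm t x \<bullet> H t x)"
      using eqE[OF t EL2] unfolding pairing_exists_def D'_def[symmetric]
      by (auto intro!: sq_int_integrable_inner sq_int_scaleR H.sq_int_Z H.sq_int_Z' t Jm_sq'
          simp del: inner_scaleR_left)
    have ZZ'_meas: "(\<lambda>x. Z (E t) (H t) x \<bullet> Z' t x) \<in> borel_measurable ?M"
      using Zsq[OF t] Z'sq[OF t] sq_int_integrable_inner by blast
    have ZJ_meas: "(\<lambda>x. J t x \<bullet> Z (E t) (H t) x) \<in> borel_measurable ?M"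
      using Zsq[OF t] J_sq[OF t] sq_int_integrable_inner by blast
    have "(LINT x|?M. Z (E t) (H t) x \<bullet> Z' t x) = (LINT x|?M. D' x \<bullet> E t x + (mu0 *\<^sub>R H' t x) \<bullet> H t x)"
    proof (rule integral_cong_AE)
      show "AE x in ?M. Z (E t) (H t) x \<bullet> Z' t x = D' x \<bullet> E t x + (mu0 *\<^sub>R H' t x) \<bullet> H t x"
        using ab
      proof eventually_elim
        case (elim x)
        have "Z (E t) (H t) x \<bullet> Z' t x = (\<alpha> x)\<^sup>2 * (E t x \<bullet> E' t x)
            + 2 * (\<beta> x)\<^sup>2 * (norm (E t x))\<^sup>2 * (E t x \<bullet> E' t x) + \<gamma>\<^sup>2 * (H t x \<bullet> H' t x)"
          by (simp add: Z_def Z'_def energy_field_def energy_field_derivative_def power2_eq_square algebra_simps)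
        also have "\<dots> = D' x \<bullet> E t x + (mu0 *\<^sub>R H' t x) \<bullet> H t x"
          using elim by (simp add: D'_def permittivity_mult_vec_inner g2 inner_commute[of "H t x"] algebra_simps)
        finally show ?case .
      qed
    qed (use ZZ'_meas int in auto)
    also have "\<dots> = pairing \<Omega> D' (E t) + pairing \<Omega> (\<lambda>x. mu0 *\<^sub>R H' t x) (H t)"
      unfolding pairing_def using int(1,3) by (rule Bochner_Integration.integral_add)
    \<comment> \<open>The first equation is tested with \<open>E t\<close>, the second with
      \<open>H t\<close>. Both then contain the pairing of \<open>E t\<close> with the curl of
      \<open>H t\<close>, with opposite signs.\<close>
    also have "\<dots> = - (pairing \<Omega> (Je t) (E t) + pairing \<Omega> (Jm t) (H t))"
      using eqE[OF t EL2] eqH[OF t Hcurl[OF t]]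
      unfolding D'_def[abs_def] by (simp add: pairing_def inner_commute)
    also have "pairing \<Omega> (Je t) (E t) + pairing \<Omega> (Jm t) (H t) =
        (LINT x|?M. Je t x \<bullet> E t x + Jm t x \<bullet> H t x)"
      unfolding pairing_def using int(2,4) by (rule Bochner_Integration.integral_add[symmetric])
    also have "\<dots> = (LINT x|?M. J t x \<bullet> Z (E t) (H t) x)"
    proof (rule integral_cong_AE)
      show "AE x in ?M. Je t x \<bullet> E t x + Jm t x \<bullet> H t x = J t x \<bullet> Z (E t) (H t) x"
        using ab
      proof eventually_elim
        case (elim x)
        have "sqrt (we x) * \<alpha> x = 1" "sqrt (wm x) * \<gamma> = 1"
          using elim g2 by (auto simp: we_def wm_def \<alpha>_def \<gamma>_def real_sqrt_divide)
        moreover have "J t x \<bullet> Z (E t) (H t) x =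
            (sqrt (we x) * \<alpha> x) * (Je t x \<bullet> E t x) + (sqrt (wm x) * \<gamma>) * (Jm t x \<bullet> H t x)"
          by (simp add: J_def Z_def energy_field_def)
        ultimately show ?case
          by simp
      qed
    qed (use ZJ_meas int in auto)
    finally show ?thesis .
  qed

  \<comment> \<open>The squared norm of the energy field as a function of time\<close>
  \<comment> \<open>The value at 0 is set by hand: \<open>E 0\<close> and \<open>H 0\<close> are
    unconstrained, the initial data being prescribed only as limits from the right.\<close>
  define f where "f t = (l2 ?M (if t = 0 then Z E0 H0 else Z (E t) (H t)))\<^sup>2" for t
  have f_deriv: "(f has_real_derivative 2 * (LINT x|?M. Z (E t) (H t) x \<bullet> Z' t x)) (at t)"
    if t: "t \<in> {0<..<T}" for t
  proof -
    have "((\<lambda>s. (l2 ?M (Z (E s) (H s)))\<^sup>2) has_real_derivative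
        2 * (LINT x|?M. Z (E t) (H t) x \<bullet> Z' t x)) (at t)"
      using Z.has_real_derivative_weighted_norm[OF t, of "\<lambda>_. 1" 1] by (simp add: l2_power2)
    moreover have "\<forall>\<^sub>F s in nhds t. s \<in> {0<..<T}"
      using t by (intro eventually_nhds_in_open) auto
    then have "\<forall>\<^sub>F s in nhds t. (l2 ?M (Z (E s) (H s)))\<^sup>2 = f s"
      by eventually_elim (simp add: f_def)
    ultimately show ?thesis
      by (simp add: DERIV_cong_ev)
  qed
  have f_cont: "continuous_on {0..t0} f"
    unfolding continuous_on_eq_continuous_within
  proof
    fix t assume t: "t \<in> {0..t0}"
    show "continuous (at t within {0..t0}) f"
    proof (cases "t = 0")
      case False
      then have "t \<in> {0<..<T}" using t t0 by auto
      then show ?thesis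
        using DERIV_isCont[OF f_deriv] continuous_at_imp_continuous_at_within by blast
    next
      case True
      \<comment> \<open>Continuity at 0 comes from the Lipschitz distance \<open>B * s\<close> to
        the initial energy field.\<close>
      have "((\<lambda>s. (l2 ?M (Z (E s) (H s)))\<^sup>2) \<longlongrightarrow> (l2 ?M (Z E0 H0))\<^sup>2) (at_right 0)"
      proof (rule l2_power2_tendsto[OF _ Z0sq])
        have ev: "\<forall>\<^sub>F s in at_right 0. s \<in> {0<..<T}"
          using T by (simp add: eventually_at_right_field)  (auto intro!: exI[of _ T])
        then show "\<forall>\<^sub>F s in at_right 0. sq_int ?M (Z (E s) (H s))"
          by eventually_elim (rule Zsq)
        show "((\<lambda>s. l2 ?M (\<lambda>x. Z (E s) (H s) x - Z E0 H0 x)) \<longlongrightarrow> 0) (at_right 0)"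
        proof (rule Lim_null_comparison)
          show "\<forall>\<^sub>F s in at_right 0. norm (l2 ?M (\<lambda>x. Z (E s) (H s) x - Z E0 H0 x)) \<le> B * s"
            using ev by eventually_elim (simp add: Z0_le)
          show "((\<lambda>s. B * s) \<longlongrightarrow> 0) (at_right 0)"
            by (auto intro!: tendsto_eq_intros)
        qed
      qed
      moreover have "\<forall>\<^sub>F s in at_right 0. (l2 ?M (Z (E s) (H s)))\<^sup>2 = f s"
        by (auto simp: eventually_at_filter f_def)
      ultimately have "(f \<longlongrightarrow> f 0) (at_right 0)"
        by (subst (asm) tendsto_cong) (auto simp: f_def)
      then show ?thesis
        using True t0 by (simp add: continuous_within at_within_Icc_at_right)
    qed
  qed

  \<comment> \<open>The time integral of the currents and the conclusion\<close>
  define GE GM where "GE = L2_time_sqnorm T (sqnorm \<Omega> we) Je" and "GM = L2_time_sqnorm T (sqnorm \<Omega> wm) Jm"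
  have "GE + GM < \<infinity>"
    using assms(14,15) by (auto simp: L2_time_def GE_def GM_def)
  then obtain G where G: "GE + GM = ennreal G" "0 \<le> G"
    by (cases "GE + GM") auto
  have J_G: "(\<integral>\<^sup>+s. ennreal ((l2 ?M (J s))\<^sup>2) \<partial>lebesgue_on {0<..<t0}) \<le> ennreal G"
  proof -
    let ?I = "lebesgue_on {0<..<T}"
    obtain ge gm where g: "ge \<in> borel_measurable ?I" "gm \<in> borel_measurable ?I"
        "AE s in ?I. sqnorm \<Omega> we (Je s) = ge s" "AE s in ?I. sqnorm \<Omega> wm (Jm s) = gm s"
      using strongly_measurable_sqnorm[OF we assms(14)] strongly_measurable_sqnorm[OF wm assms(15)] by blast
    \<comment> \<open>The integral is enlarged from (0, t0) to (0, T), as the bound to be shown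
      involves the norms of the currents on the whole time interval.\<close>
    have "(\<integral>\<^sup>+s. ennreal ((l2 ?M (J s))\<^sup>2) \<partial>lebesgue_on {0<..<t0})
        \<le> (\<integral>\<^sup>+s. ennreal ((l2 ?M (J s))\<^sup>2) \<partial>?I)"
      using t0 by (auto simp: nn_integral_restrict_space indicator_def intro!: nn_integral_mono)
    also have "\<dots> = (\<integral>\<^sup>+s. ge s + gm s \<partial>?I)"
    proof (rule nn_integral_cong_AE)
      show "AE s in ?I. ennreal ((l2 ?M (J s))\<^sup>2) = ge s + gm s"
        using g(3,4) AE_space by eventually_elim (simp add: J_l2)
    qed
    also have "\<dots> = (\<integral>\<^sup>+s. ge s \<partial>?I) + (\<integral>\<^sup>+s. gm s \<partial>?I)"
      using g(1,2) by (rule nn_integral_add)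
    also have "\<dots> = GE + GM"
      unfolding GE_def GM_def L2_time_sqnorm_def
      using nn_integral_cong_AE[OF g(3)] nn_integral_cong_AE[OF g(4)] by simp
    finally show ?thesis
      using G by simp
  qed

  have energy: "energy \<Omega> eps0 mu0 chi1 chi3 e h = ennreal (1/2 * (l2 ?M (Z e h))\<^sup>2)"
    if "sq_int ?M (Z e h)" for e h
    using that energy_eq_l2[OF eps0 mu0 \<open>AE x in ?M. 0 \<le> chi1 x\<close> \<open>AE x in ?M. 0 \<le> chi3 x\<close>, of e h]
    unfolding Z_def \<alpha>_def[abs_def] \<beta>_def[abs_def] \<gamma>_def by blast
  \<comment> \<open>The growth estimate with N the squared norm of \<open>J\<close>; its condition
    on the derivative is the balance combined with Cauchy-Schwarz.\<close>
  have "f t0 \<le> 2 * f 0 + 2 * t0 * G"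
  proof (rule sqrt_growth[OF _ f_cont _ f_deriv _ _ J_G G(2)])
    fix t assume t: "t \<in> {0<..<t0}"
    then have tT: "t \<in> {0<..<T}" using t0 by auto
    show "\<bar>2 * (LINT x|?M. Z (E t) (H t) x \<bullet> Z' t x)\<bar> \<le> 2 * sqrt ((l2 ?M (J t))\<^sup>2) * sqrt (f t)"
      using l2_Cauchy_Schwarz[OF J_sq[OF tT] Zsq[OF tT]] balance[OF tT] t by (simp add: f_def)
  qed (use t0 in \<open>auto simp: f_def\<close>)
  \<comment> \<open>The energy is half of \<open>f\<close>, so halving removes the 2 in front of
    \<open>t0 * G\<close> and keeps the one in front of the initial energy.\<close>
  then have le: "1/2 * (l2 ?M (Z (E t0) (H t0)))\<^sup>2 \<le> 2 * (1/2 * (l2 ?M (Z E0 H0))\<^sup>2) + t0 * G"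
    using t0 by (simp add: f_def)
  have "ennreal (2 * a + t0 * G) = 2 * ennreal a + ennreal t0 * ennreal G" if "0 \<le> a" for a
    using that t0 G(2) by (simp add: ennreal_plus ennreal_mult ennreal_mult[of 2])
  then have "ennreal (1/2 * (l2 ?M (Z (E t0) (H t0)))\<^sup>2) \<le>
      2 * ennreal (1/2 * (l2 ?M (Z E0 H0))\<^sup>2) + ennreal t0 * ennreal G"
    using ennreal_leI[OF le] by (metis mult_nonneg_nonneg zero_le_divide_1_iff zero_le_numeral zero_le_power2)
  then show "energy \<Omega> eps0 mu0 chi1 chi3 (E t0) (H t0) \<le> 2 * energy \<Omega> eps0 mu0 chi1 chi3 E0 H0
      + ennreal t0 * (L2_time_sqnorm T (sqnorm \<Omega> we) Je + L2_time_sqnorm T (sqnorm \<Omega> wm) Jm)"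
    unfolding energy[OF Zsq[OF t0]] energy[OF Z0sq] GE_def[symmetric] GM_def[symmetric] G(1) .
qed

end
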